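(* Let $K\subset\mathbb{R}^n$ be a compact set whose interior contains the origin and which is starlike with respect to the origin. Let $g:\mathbb{R}_{\ge 0}\to\mathbb{R}_{>0}$ be an injective function for which the composition $f(x)=g(\|x\|_K)$, $x\in\mathbb{R}^n$, satisfies: (a) $\dfrac{f(ux)}{f(x)}\ge\dfrac{f(utx)}{f(tx)}$ for all $x\in\mathbb{R}^n$ and all $u,t\in(0,1]$; (b) $f$ is continuous; (c) $f(x)=O((1+\|x\|_2)^{-n-\delta})$ for some $\delta>0$; (d) $\sum_{\lambda\in\Lambda^*}|\widehat f(t\lambda)|<\infty$ for every lattice $\Lambda\subset\mathbb{R}^n$ and every $t>0$; (e) $\widehat f$ is real-valued, nonnegative, and monotonically non-increasing on rays, i.e. $0\le\widehat f(tv)\le\widehat f(v)$ for all $v\in\mathbb{R}^n$ and $t\ge 1$. Then for any $r>0$, $$\nu_f(rK)\ \le\ \mu_g(r),\qquad\text{where}\qquad \mu_g(r):=\frac{g(r)}{\sup_{0<u\le 1}u^n g(ur)}.$$ In particular, for any lattice $\Lambda\subset\mathbb{R}^n$ and any $v\in\mathbb{R}^n$, $$\sum_{\lambda\in\Lambda,\ \|\lambda+v\|_K\ge r} f(\lambda+v)\ \le\ \mu_g(r)\sum_{\lambda\in\Lambda} f(\lambda).$$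
   Context: A lattice $\Lambda\subset\mathbb{R}^n$ is the set of integral linear combinations of some basis of $\mathbb{R}^n$; its dual is $\Lambda^*=\{x\in\mathbb{R}^n: x\cdot\lambda\in\mathbb{Z}\ \text{for all }\lambda\in\Lambda\}$. The Fourier transform is $\widehat f(x)=\int_{\mathbb{R}^n} f(r)e^{-2\pi i r\cdot x}\,dr$. $\|x\|_2$ is the Euclidean norm and $\|x\|_K:=\min\{r\ge 0: x\in rK\}$; $K$ starlike with respect to the origin means that for each $r>0$, $x\notin rK\iff\|x\|_K>r$ (equivalently $tK\subset K$ for all $t\in[0,1]$). For $S\subset\mathbb{R}^n$, $$\nu_f(S):=\inf_{0<u\le 1}\ \sup_{x\notin S}\ \frac{f(x)}{u^n f(ux)}.$$ *)

theory Defs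
  imports "HOL-Analysis.Analysis" "HOL-Library.Landau_Symbols"
begin

definition is_lattice :: "(real ^ 'n) set \<Rightarrow> bool" where
  "is_lattice \<Lambda> \<longleftrightarrow>
     (\<exists>B. independent B \<and> span B = UNIV \<and>
          \<Lambda> = {(\<Sum>b\<in>B. of_int (c b) *\<^sub>R b) | c :: real ^ 'n \<Rightarrow> int. True})"

definition dual_lattice :: "(real ^ 'n) set \<Rightarrow> (real ^ 'n) set" where
  "dual_lattice \<Lambda> = {x. \<forall>l\<in>\<Lambda>. x \<bullet> l \<in> \<int>}"

definition fourier :: "(real ^ 'n \<Rightarrow> real) \<Rightarrow> real ^ 'n \<Rightarrow> complex" where
  "fourier f x =
     (LINT y|lborel. complex_of_real (f y) * exp (- 2 * of_real pi * \<i> * of_real (y \<bullet> x)))"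

definition dilate :: "real \<Rightarrow> (real ^ 'n) set \<Rightarrow> (real ^ 'n) set" where
  "dilate r K = (\<lambda>y. r *\<^sub>R y) ` K"

(* The minimum exists for every x if K is compact with the origin in its interior; otherwise the
   value of LEAST may be unspecified. *)
definition knorm :: "(real ^ 'n) set \<Rightarrow> real ^ 'n \<Rightarrow> real" where
  "knorm K x = (LEAST r. 0 \<le> r \<and> x \<in> dilate r K)"

definition starlike_origin :: "(real ^ 'n) set \<Rightarrow> bool" where
  "starlike_origin K \<longleftrightarrow> (\<forall>r>0. \<forall>x. x \<notin> dilate r K \<longleftrightarrow> r < knorm K x)"

(* Extended reals, because the inner supremum may be infinite for some u. *)
definition nu :: "(real ^ 'n \<Rightarrow> real) \<Rightarrow> (real ^ 'n) set \<Rightarrow> ereal" where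
  "nu f S = (INF u\<in>{0<..1}. SUP x\<in>- S. ereal (f x / (u ^ CARD('n) * f (u *\<^sub>R x))))"

(* A real supremum: meaningful if g is bounded on {0<..r}, e.g. if g is continuous on {0..r}. *)
definition mu :: "nat \<Rightarrow> (real \<Rightarrow> real) \<Rightarrow> real \<Rightarrow> real" where
  "mu n g r = g r / (SUP u\<in>{0<..1}. u ^ n * g (u * r))"

end

theory Submission
  imports Defs
begin

text \<open>Fix \<open>u\<close> in \<open>(0, 1]\<close>. Write \<open>n\<close> for the dimension, \<open>F\<close> for the Fourier transform of \<open>f\<close>, and \<open>V\<close> for the volume of a
fundamental cell of \<open>\<Lambda>\<close>. Poisson summation for the lattice \<open>u\<Lambda>\<close> at the point \<open>uv\<close> reads
  \<open>u^n V (\<Sum>l\<in>\<Lambda>. f (u (l + v))) = (\<Sum>z\<in>\<Lambda>*. F (z / u) exp (2 pi i z \<bullet> v))\<close>.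
As \<open>F\<close> is nonnegative and does not increase along rays, the right-hand side is at most
\<open>(\<Sum>z\<in>\<Lambda>*. F (z / u)) \<le> (\<Sum>z\<in>\<Lambda>*. F z)\<close>, which is \<open>V (\<Sum>l\<in>\<Lambda>. f l)\<close> by Poisson summation for \<open>\<Lambda>\<close> itself. So
shifting and contracting a lattice sum, with the factor \<open>u^n\<close>, never makes it larger than the sum over the
lattice (lemma \<open>lattice_sum_dilate_le\<close>).

The rest is pointwise. If the gauge of \<open>x\<close> is at least \<open>r\<close>, then \<open>t x\<close> has gauge exactly \<open>r\<close> for a suitable
\<open>t\<close> in \<open>(0, 1]\<close>, and hypothesis (a) becomes \<open>f x \<le> (g r / g (u r)) f (u x)\<close>. This bounds the inner
supremum in \<open>\<nu>\<close> for every \<open>u\<close>. Summed over the shifted lattice points of gauge at least \<open>r\<close>, it gives the bound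
\<open>g r / (u^n g (u r))\<close> times the full lattice sum. Optimising over \<open>u\<close> yields \<open>\<mu>\<close> (lemma \<open>le_divide_SUP\<close>).

Poisson summation (theorem \<open>poisson_summation\<close>) compares two continuous periodic functions, the periodisation of
\<open>f\<close> and its Fourier series. Their Fourier coefficients agree because an integral over the whole space is the
integral over one cell of the sum over all lattice translates (lemma \<open>unfold_integral\<close>), and because characters
are orthogonal on the cell (lemma \<open>integral_character_cell\<close>). Continuous periodic functions with equal Fourier
coefficients coincide by the Stone-Weierstrass theorem on the torus (lemma \<open>fourier_coeffs_unique\<close>).\<close>

section \<open>Series over countable index sets and continuous functions\<close>

text \<open>An enumeration of the index set reduces this to the interchange of integral and series for sequences; absolute
summability makes the unordered sums independent of the enumeration.\<close>

lemma integral_infsum: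
  fixes g :: "'i::countable \<Rightarrow> 'a \<Rightarrow> complex"
  assumes inf: "infinite (UNIV :: 'i set)"
    and int: "\<And>i. integrable M (g i)"
    and pt: "\<And>x. (\<lambda>i. norm (g i x)) summable_on UNIV"
    and tot: "(\<lambda>i. LINT x|M. norm (g i x)) summable_on UNIV"
  shows "integrable M (\<lambda>x. \<Sum>\<^sub>\<infinity>i. g i x)"
    and "(LINT x|M. (\<Sum>\<^sub>\<infinity>i. g i x)) = (\<Sum>\<^sub>\<infinity>i. LINT x|M. g i x)"
proof -
  define \<nu> :: "nat \<Rightarrow> 'i" where "\<nu> = from_nat_into UNIV"
  have bij: "bij_betw \<nu> UNIV UNIV"
    unfolding \<nu>_def using inf by (intro bij_betw_from_nat_into) auto
  have reindex: "infsum h UNIV = suminf (\<lambda>n. h (\<nu> n))"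
    if "(\<lambda>i. norm (h i)) summable_on UNIV" for h :: "'i \<Rightarrow> complex"
  proof -
    have "infsum h UNIV = infsum (\<lambda>n. h (\<nu> n)) UNIV"
      using infsum_reindex_bij_betw[OF bij, of h] by simp
    also have "(\<lambda>n. h (\<nu> n)) summable_on UNIV"
      using that summable_on_reindex_bij_betw[OF bij, of h] abs_summable_summable by blast
    then have "infsum (\<lambda>n. h (\<nu> n)) UNIV = suminf (\<lambda>n. h (\<nu> n))"
      using has_sum_imp_sums sums_unique by (metis has_sum_infsum)
    finally show ?thesis .
  qed
  have pt': "summable (\<lambda>n. norm (g (\<nu> n) x))" for x
    using pt[of x] summable_on_reindex_bij_betw[OF bij, of "\<lambda>i. norm (g i x)"]
    by (intro summable_on_imp_summable) auto
  have tot': "summable (\<lambda>n. LINT x|M. norm (g (\<nu> n) x))"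
    using tot summable_on_reindex_bij_betw[OF bij, of "\<lambda>i. LINT x|M. norm (g i x)"]
    by (intro summable_on_imp_summable) auto
  have eq: "(\<lambda>x. \<Sum>\<^sub>\<infinity>i. g i x) = (\<lambda>x. \<Sum>n. g (\<nu> n) x)"
    by (intro ext reindex pt)
  show "integrable M (\<lambda>x. \<Sum>\<^sub>\<infinity>i. g i x)"
    unfolding eq using int pt' tot' by (intro integrable_suminf) auto
  have "(\<lambda>i. norm (LINT x|M. g i x)) summable_on UNIV"
    by (rule Infinite_Sum.abs_summable_on_comparison_test'[OF tot]) simp
  then have "(\<Sum>\<^sub>\<infinity>i. LINT x|M. g i x) = (\<Sum>n. LINT x|M. g (\<nu> n) x)"
    by (rule reindex)
  also have "\<dots> = (LINT x|M. (\<Sum>n. g (\<nu> n) x))"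
    using int pt' tot' by (intro integral_suminf[symmetric]) auto
  finally show "(LINT x|M. (\<Sum>\<^sub>\<infinity>i. g i x)) = (\<Sum>\<^sub>\<infinity>i. LINT x|M. g i x)"
    by (simp add: eq)
qed

lemma infinite_UNIV_fun_int: "infinite (UNIV :: ('n \<Rightarrow> int) set)"
proof -
  have "inj (\<lambda>j::int. (\<lambda>_::'n. j))" by (auto simp: inj_def fun_eq_iff)
  then show ?thesis
    using finite_imageD[of "\<lambda>j::int. (\<lambda>_::'n. j)" UNIV] infinite_UNIV_int
    by (meson finite_subset subset_UNIV)
qed

lemma summable_on_int_powr:
  assumes "1 < s"
  shows "(\<lambda>j::int. (1 + real_of_int \<bar>j\<bar>) powr (- s)) summable_on UNIV"
proof -
  have "summable (\<lambda>n. real n powr (- s))"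
    using assms by (subst summable_real_powr_iff) auto
  then have "summable (\<lambda>n. real (Suc n) powr (- s))"
    by (subst summable_Suc_iff)
  then have nat: "(\<lambda>n. (1 + real n) powr (- s)) summable_on UNIV"
    by (subst summable_on_UNIV_nonneg_real_iff) (simp_all add: add_ac)
  have "(\<lambda>j::int. (1 + real_of_int \<bar>j\<bar>) powr (- s)) summable_on range int"
    using nat by (subst summable_on_reindex) (auto simp: o_def)
  moreover have "(\<lambda>j::int. (1 + real_of_int \<bar>j\<bar>) powr (- s)) summable_on range (\<lambda>n. - int n)"
    using nat by (subst summable_on_reindex) (auto simp: o_def inj_def)
  moreover have "range int \<union> range (\<lambda>n. - int n) = UNIV"
  proof (intro equalityI subsetI UNIV_I)
    fix j :: int
    show "j \<in> range int \<union> range (\<lambda>n. - int n)"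
      by (cases j rule: int_cases) (auto simp del: of_nat_Suc intro: range_eqI[of _ _ "Suc _"])
  qed
  ultimately show ?thesis
    by (metis summable_on_union)
qed

text \<open>A majorant of product form for lattice sums: for \<open>m\<close> in \<open>\<int>^n\<close>, every factor \<open>1 + |m i|\<close> is at most
\<open>1 + norm m\<close>, so \<open>(1 + norm m) powr (- n s)\<close> is at most the product below. The sum of the products over \<open>\<int>^n\<close>
factorises into \<open>n\<close> convergent one-dimensional series.\<close>

lemma summable_on_prod_int_powr:
  assumes "1 < s"
  shows "(\<lambda>m::'n::finite \<Rightarrow> int. \<Prod>i\<in>UNIV. (1 + real_of_int \<bar>m i\<bar>) powr (- s)) summable_on UNIV"
proof -
  have "Infinite_Set_Sum.abs_summable_on (\<lambda>j::int. (1 + real_of_int \<bar>j\<bar>) powr (- s)) UNIV"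
    using summable_on_int_powr[OF assms] by (subst abs_summable_equivalent[symmetric]) simp
  then have "Infinite_Set_Sum.abs_summable_on
      (\<lambda>m. \<Prod>i\<in>UNIV. (1 + real_of_int \<bar>m i\<bar>) powr (- s)) (PiE (UNIV::'n set) (\<lambda>_. UNIV))"
    by (intro abs_summable_on_prod_PiE) auto
  then show ?thesis
    by (subst (asm) abs_summable_equivalent[symmetric]) (auto intro: abs_summable_summable)
qed

lemma continuous_on_infsum:
  fixes f :: "'i \<Rightarrow> 'a::topological_space \<Rightarrow> complex"
  assumes "\<And>i. continuous_on S (f i)" "\<And>i x. x \<in> S \<Longrightarrow> norm (f i x) \<le> B i" "B summable_on UNIV"
  shows "continuous_on S (\<lambda>x. \<Sum>\<^sub>\<infinity>i. f i x)"
proof (rule uniform_limit_theorem)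
  show "uniform_limit S (\<lambda>X x. \<Sum>i\<in>X. f i x) (\<lambda>x. \<Sum>\<^sub>\<infinity>i. f i x) (finite_subsets_at_top UNIV)"
    using assms(2,3) by (intro Weierstrass_m_test_general[where M = B]) auto
  show "\<forall>\<^sub>F X in finite_subsets_at_top UNIV. continuous_on S (\<lambda>x. \<Sum>i\<in>X. f i x)"
    using assms(1) by (intro always_eventually allI continuous_on_sum) auto
qed simp

lemma continuous_AE_zero:
  fixes h :: "'a::euclidean_space \<Rightarrow> real"
  assumes "continuous_on UNIV h" "AE x in lborel. h x = 0"
  shows "h x = 0"
proof -
  have op: "open {x. h x \<noteq> 0}"
    using assms(1) by (intro open_Collect_neq) auto
  then have "{x. h x \<noteq> 0} \<in> null_sets lborel"
    using assms(2) by (subst AE_iff_null_sets) auto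
  then have "negligible {x. h x \<noteq> 0}"
    by (simp add: negligible_iff_null_sets null_sets_completionI)
  then have "{x. h x \<noteq> 0} = {}" using op open_not_negligible by blast
  then show ?thesis by blast
qed

section \<open>Lattices and their fundamental cells\<close>

lemma lborel_integral_shift:
  fixes h :: "'a::euclidean_space \<Rightarrow> 'b::{banach, second_countable_topology}"
  assumes "h \<in> borel_measurable borel"
  shows "(LINT x|lborel. h (x + a)) = (LINT x|lborel. h x)"
proof -
  have "(LINT x|lborel. h x) = (LINT x|distr lborel borel ((+) a). h x)"
    by (simp add: lborel_distr_plus)
  also have "\<dots> = (LINT x|lborel. h (a + x))"
    using assms by (intro integral_distr) auto
  finally show ?thesis by (simp add: add.commute)
qed

lemma lborel_integrable_shift:
  fixes h :: "'a::euclidean_space \<Rightarrow> 'b::{banach, second_countable_topology}"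
  assumes "integrable lborel (\<lambda>x. h (x + a))" "h \<in> borel_measurable borel"
  shows "integrable lborel h"
proof -
  have "integrable (distr lborel borel ((+) a)) h"
    using assms by (subst integrable_distr_eq) (auto simp: add.commute)
  then show ?thesis by (simp add: lborel_distr_plus)
qed

text \<open>The lattice is the image of \<open>\<int>^n\<close> under a linear bijection \<open>L\<close>. Its inverse \<open>M\<close> reads off coordinates with
respect to the lattice basis, so that integrality conditions become conditions on single coordinates. Lattice
points and characters are both indexed by integer vectors.\<close>

locale lattice_frame =
  fixes L M :: "real ^ 'n \<Rightarrow> real ^ 'n"
  assumes linear_L: "linear L" and linear_M: "linear M"
    and M_L: "M (L y) = y" and L_M: "L (M x) = x"
begin

definition lattice_pt :: "('n \<Rightarrow> int) \<Rightarrow> real ^ 'n" where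
  "lattice_pt m = L (\<chi> i. of_int (m i))"

definition cell :: "(real ^ 'n) set" where
  "cell = {x. \<forall>i. 0 \<le> M x $ i \<and> M x $ i < 1}"

definition covolume :: real where
  "covolume = measure lborel cell"

definition character :: "('n \<Rightarrow> int) \<Rightarrow> real ^ 'n \<Rightarrow> complex" where
  "character k x = cis (2 * pi * (\<Sum>i\<in>UNIV. of_int (k i) * M x $ i))"

lemma M_add: "M (x + y) = M x + M y" and M_diff: "M (x - y) = M x - M y"
  using linear_M by (simp_all add: linear_add linear_diff)

lemma M_pt: "M (lattice_pt m) $ i = of_int (m i)"
  by (simp add: lattice_pt_def M_L)

lemma continuous_on_M: "continuous_on S M"
  using linear_M by (rule linear_continuous_on[OF linear_conv_bounded_linear[THEN iffD1]])

lemma continuous_on_L: "continuous_on S L"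
  using linear_L by (rule linear_continuous_on[OF linear_conv_bounded_linear[THEN iffD1]])

lemma lattice_pt_minus: "lattice_pt (\<lambda>i. - m i) = - lattice_pt m"
proof -
  have "(\<chi> i. real_of_int (- m i)) = - (\<chi> i. real_of_int (m i))" by (simp add: vec_eq_iff)
  then show ?thesis unfolding lattice_pt_def using linear_L by (simp add: linear_neg)
qed

lemma norm_character [simp]: "norm (character k x) = 1"
  by (simp add: character_def)

lemma character_zero [simp]: "character (\<lambda>_. 0) x = 1"
  by (simp add: character_def)

lemma character_plus: "character k (x + a) = character k x * character k a"
  by (simp add: character_def M_add cis_mult algebra_simps sum.distrib)

lemma character_mult: "character k x * character l x = character (\<lambda>i. k i + l i) x"
  by (simp add: character_def cis_mult algebra_simps sum.distrib)

lemma character_uminus: "character (\<lambda>i. - k i) x = cnj (character k x)"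
  by (simp add: character_def cis_cnj sum_negf)

lemma character_pt [simp]: "character k (lattice_pt m) = 1"
proof -
  have "(\<Sum>i\<in>UNIV. of_int (k i) * M (lattice_pt m) $ i) = real_of_int (\<Sum>i\<in>UNIV. k i * m i)"
    by (simp add: M_pt)
  then show ?thesis
    unfolding character_def by (metis Ints_of_int cis_multiple_2pi)
qed

lemma continuous_on_character: "continuous_on S (character k)"
  unfolding character_def cis_conv_exp
  by (intro continuous_intros continuous_on_M)

lemma cell_borel [measurable]: "cell \<in> sets borel"
proof -
  have "cell = (\<Inter>i. {x. 0 \<le> M x $ i} \<inter> {x. M x $ i < 1})"
    by (auto simp: cell_def)
  also have "\<dots> \<in> sets borel"
    by (intro sets.finite_INT sets.Int borel_closed borel_open closed_Collect_le open_Collect_less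
        continuous_intros continuous_on_M) auto
  finally show ?thesis .
qed

definition closed_cell :: "(real ^ 'n) set" where
  "closed_cell = L ` cbox 0 1"

lemma compact_closed_cell: "compact closed_cell"
  unfolding closed_cell_def by (intro compact_continuous_image continuous_on_L compact_cbox)

lemma cell_subset: "cell \<subseteq> closed_cell"
proof
  fix x assume "x \<in> cell"
  then have "M x \<in> cbox 0 1" by (auto simp: cell_def mem_box_cart less_imp_le)
  then show "x \<in> closed_cell" unfolding closed_cell_def by (metis L_M image_eqI)
qed

lemma emeasure_cell: "emeasure lborel cell < \<infinity>"
  by (rule emeasure_bounded_finite[OF bounded_subset[OF compact_imp_bounded cell_subset]])
    (rule compact_closed_cell)

lemma covolume_pos: "0 < covolume"
proof -
  let ?U = "{x. \<forall>i. 0 < M x $ i \<and> M x $ i < 1}"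
  have "open ?U"
  proof -
    have "?U = (\<Inter>i. {x. 0 < M x $ i} \<inter> {x. M x $ i < 1})" by auto
    also have "open \<dots>"
      by (intro open_INT open_Int open_Collect_less continuous_intros continuous_on_M ballI) auto
    finally show ?thesis .
  qed
  moreover have "L (\<chi> i. 1/2) \<in> ?U" by (simp add: M_L)
  ultimately have "\<not> negligible ?U" using open_not_negligible by blast
  moreover have "?U \<subseteq> cell" by (auto simp: cell_def less_imp_le)
  ultimately have "\<not> negligible cell" using negligible_subset by blast
  then have "emeasure lborel cell \<noteq> 0"
    by (auto simp: negligible_iff_null_sets intro!: null_sets_completionI null_setsI)
  then show ?thesis
    unfolding covolume_def using emeasure_cell by (simp add: measure_def enn2real_positive_iff zero_less_iff_neq_zero)
qed

lemma in_cell_shift_iff: "x + lattice_pt m \<in> cell \<longleftrightarrow> m = (\<lambda>i. - \<lfloor>M x $ i\<rfloor>)"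
proof -
  have "x + lattice_pt m \<in> cell \<longleftrightarrow> (\<forall>i. 0 \<le> M x $ i + of_int (m i) \<and> M x $ i + of_int (m i) < 1)"
    by (simp add: cell_def M_add M_pt)
  also have "\<dots> \<longleftrightarrow> (\<forall>i. m i = - \<lfloor>M x $ i\<rfloor>)"
    by (intro iff_allI) linarith
  finally show ?thesis by (simp add: fun_eq_iff)
qed

lemma in_cell_shift_iff': "x - lattice_pt m \<in> cell \<longleftrightarrow> m = (\<lambda>i. \<lfloor>M x $ i\<rfloor>)"
  using in_cell_shift_iff[of x "\<lambda>i. - m i"] by (auto simp: lattice_pt_minus fun_eq_iff)

text \<open>The translates of the half-open cell tile the space, so every one of these sums has exactly one nonzero term: the
floors of the coordinates of \<open>x\<close> determine it.\<close>

lemma infsum_tiles: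
  fixes f :: "real ^ 'n \<Rightarrow> complex"
  shows "(\<lambda>m. norm (indicator cell (x - lattice_pt m) *\<^sub>R f x)) summable_on UNIV"
    and "(\<Sum>\<^sub>\<infinity>m. indicator cell (x - lattice_pt m) *\<^sub>R f x) = f x"
    and "(\<Sum>\<^sub>\<infinity>m. indicator cell (x + lattice_pt m) *\<^sub>R f x) = f x"
proof -
  let ?m = "\<lambda>i. \<lfloor>M x $ i\<rfloor>"
  have "(\<lambda>m. norm (indicator cell (x - lattice_pt m) *\<^sub>R f x)) summable_on {?m}" by simp
  then show "(\<lambda>m. norm (indicator cell (x - lattice_pt m) *\<^sub>R f x)) summable_on UNIV"
    by (rule summable_on_cong_neutral[THEN iffD1, rotated -1]) (auto simp: in_cell_shift_iff' indicator_def)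
  have "(\<Sum>\<^sub>\<infinity>m. indicator cell (x - lattice_pt m) *\<^sub>R f x) = (\<Sum>\<^sub>\<infinity>m\<in>{?m}. indicator cell (x - lattice_pt m) *\<^sub>R f x)"
    by (rule infsum_cong_neutral) (auto simp: in_cell_shift_iff' indicator_def)
  then show "(\<Sum>\<^sub>\<infinity>m. indicator cell (x - lattice_pt m) *\<^sub>R f x) = f x"
    by (simp add: in_cell_shift_iff' indicator_def)
  have "(\<Sum>\<^sub>\<infinity>m. indicator cell (x + lattice_pt m) *\<^sub>R f x)
      = (\<Sum>\<^sub>\<infinity>m\<in>{\<lambda>i. - \<lfloor>M x $ i\<rfloor>}. indicator cell (x + lattice_pt m) *\<^sub>R f x)"
    by (rule infsum_cong_neutral) (auto simp: in_cell_shift_iff indicator_def)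
  then show "(\<Sum>\<^sub>\<infinity>m. indicator cell (x + lattice_pt m) *\<^sub>R f x) = f x"
    by (simp add: in_cell_shift_iff indicator_def)
qed

lemma set_integrable_cell_bounded:
  fixes h :: "real ^ 'n \<Rightarrow> complex"
  assumes "h \<in> borel_measurable borel" "\<And>x. x \<in> cell \<Longrightarrow> norm (h x) \<le> B"
  shows "set_integrable lborel cell h" "(LINT x|lborel. norm (indicator cell x *\<^sub>R h x)) \<le> covolume * B"
proof -
  have B: "integrable lborel (\<lambda>x. indicator cell x * B)"
    using emeasure_cell by (intro integrable_mult_left integrable_real_indicator) auto
  show h: "set_integrable lborel cell h"
    unfolding set_integrable_def
    using assms(2) assms(1)[measurable]
    by (intro Bochner_Integration.integrable_bound[OF B])
      (auto simp: indicator_def intro: order_trans[OF _ abs_ge_self])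
  have "(LINT x|lborel. norm (indicator cell x *\<^sub>R h x)) \<le> (LINT x|lborel. indicator cell x * B)"
    using assms(2)
    by (intro integral_mono integrable_norm h[unfolded set_integrable_def] B) (auto simp: indicator_def)
  also have "\<dots> = covolume * B" by (simp add: covolume_def)
  finally show "(LINT x|lborel. norm (indicator cell x *\<^sub>R h x)) \<le> covolume * B" .
qed

text \<open>Cut \<open>f\<close> into its restrictions to the tiles, move each of them to the base cell by translation invariance, and
interchange sum and integral. The majorant \<open>B\<close> justifies the interchange and also gives integrability of \<open>f\<close>.\<close>

lemma unfold_integral:
  fixes f :: "real ^ 'n \<Rightarrow> complex"
  assumes f [measurable]: "f \<in> borel_measurable borel"
    and bound: "\<And>m x. x \<in> cell \<Longrightarrow> norm (f (x + lattice_pt m)) \<le> B m"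
    and B: "B summable_on UNIV"
  shows "integrable lborel f"
    and "(LINT x|lborel. f x) = (LINT x:cell|lborel. (\<Sum>\<^sub>\<infinity>m. f (x + lattice_pt m)))"
proof -
  define g where "g m x = indicator cell (x - lattice_pt m) *\<^sub>R f x" for m x
  define h where "h m x = indicator cell x *\<^sub>R f (x + lattice_pt m)" for m x
  have gh: "g m (x + lattice_pt m) = h m x" for m x by (simp add: g_def h_def)
  have gm [measurable]: "g m \<in> borel_measurable borel" for m unfolding g_def by measurable
  have hi: "integrable lborel (h m)" for m
    using set_integrable_cell_bounded(1)[OF _ bound] unfolding h_def set_integrable_def by simp
  have hn: "(LINT x|lborel. norm (h m x)) \<le> covolume * B m" for m
    using set_integrable_cell_bounded(2)[OF _ bound] unfolding h_def by simp
  have gi: "integrable lborel (g m)" for m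
    by (rule lborel_integrable_shift[where a = "lattice_pt m"]) (simp_all add: gh hi)
  have gint: "(LINT x|lborel. g m x) = (LINT x|lborel. h m x)" for m
    using lborel_integral_shift[of "g m" "lattice_pt m"] by (simp add: gh)
  have gn: "(LINT x|lborel. norm (g m x)) = (LINT x|lborel. norm (h m x))" for m
    using lborel_integral_shift[of "\<lambda>x. norm (g m x)" "lattice_pt m"] by (simp add: gh)
  have hsum: "(\<lambda>m. LINT x|lborel. norm (h m x)) summable_on UNIV"
    by (rule summable_on_comparison_test[OF summable_on_cmult_right[OF B, of covolume]]) (simp_all add: hn)
  have gpt: "(\<lambda>m. norm (g m x)) summable_on UNIV" and geq: "(\<Sum>\<^sub>\<infinity>m. g m x) = f x" for x
    unfolding g_def by (rule infsum_tiles)+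
  have hpt: "(\<lambda>m. norm (h m x)) summable_on UNIV" for x
  proof (cases "x \<in> cell")
    case True
    then show ?thesis unfolding h_def
      by (intro Infinite_Sum.abs_summable_on_comparison_test'[OF B]) (simp add: bound)
  qed (simp add: h_def)
  have gsum: "(\<lambda>m. LINT x|lborel. norm (g m x)) summable_on UNIV"
    using hsum by (simp add: gn)
  show "integrable lborel f"
    using integral_infsum(1)[OF infinite_UNIV_fun_int gi gpt gsum] by (simp add: geq)
  have "(LINT x|lborel. f x) = (\<Sum>\<^sub>\<infinity>m. LINT x|lborel. g m x)"
    using integral_infsum(2)[OF infinite_UNIV_fun_int gi gpt gsum] by (simp add: geq)
  also have "\<dots> = (\<Sum>\<^sub>\<infinity>m. LINT x|lborel. h m x)" by (simp add: gint)
  also have "\<dots> = (LINT x|lborel. (\<Sum>\<^sub>\<infinity>m. h m x))"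
    using integral_infsum(2)[OF infinite_UNIV_fun_int hi hpt hsum] by simp
  also have "(\<lambda>x. \<Sum>\<^sub>\<infinity>m. h m x) = (\<lambda>x. indicator cell x *\<^sub>R (\<Sum>\<^sub>\<infinity>m. f (x + lattice_pt m)))"
    by (auto simp: h_def indicator_def fun_eq_iff)
  finally show "(LINT x|lborel. f x) = (LINT x:cell|lborel. (\<Sum>\<^sub>\<infinity>m. f (x + lattice_pt m)))"
    by (simp add: set_lebesgue_integral_def)
qed

text \<open>For \<open>k \<noteq> 0\<close> there is a vector \<open>a\<close> at which the character is \<open>-1\<close>. Replacing \<open>x\<close> by \<open>x + a\<close> changes the sign of
the integrand. The integral stays the same, because the shifted cell also meets every orbit of the lattice
exactly once. So the integral vanishes.\<close>

lemma integral_character_cell: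
  "(LINT x:cell|lborel. character k x) = (if k = (\<lambda>_. 0) then of_real covolume else 0)"
proof (cases "k = (\<lambda>_. 0)")
  case True
  then show ?thesis using emeasure_cell
    by (simp add: set_lebesgue_integral_def covolume_def scaleR_conv_of_real less_top)
next
  case False
  then obtain j where j: "k j \<noteq> 0" by auto
  let ?I = "LINT x:cell|lborel. character k x"
  define a where "a = L (axis j (1 / (2 * of_int (k j))))"
  have Ma: "M a $ i = (if i = j then 1 / (2 * of_int (k j)) else 0)" for i
    by (auto simp: a_def M_L axis_def)
  have "(\<Sum>i\<in>UNIV. of_int (k i) * M a $ i) = (\<Sum>i\<in>UNIV. if i = j then 1/2 else 0)"
    using j by (intro sum.cong) (auto simp: Ma)
  then have half: "(\<Sum>i\<in>UNIV. of_int (k i) * M a $ i) = 1/2"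
    by simp
  have character_a: "character k a = -1"
    unfolding character_def half by simp
  define f where "f x = indicator cell (x - a) *\<^sub>R character k x" for x
  have [measurable]: "character k \<in> borel_measurable borel"
    by (intro borel_measurable_continuous_onI continuous_on_character)
  have fm [measurable]: "f \<in> borel_measurable borel" unfolding f_def by measurable
  have tile: "(\<Sum>\<^sub>\<infinity>m. f (x + lattice_pt m)) = character k x" for x
  proof -
    have "(\<Sum>\<^sub>\<infinity>m. f (x + lattice_pt m)) = (\<Sum>\<^sub>\<infinity>m. indicator cell ((x - a) + lattice_pt m) *\<^sub>R character k ((x - a) + a))"
      by (simp add: f_def character_plus algebra_simps)
    also have "\<dots> = character k x"
      using infsum_tiles(3)[of "x - a" "\<lambda>y. character k (y + a)"] by simp
    finally show ?thesis .
  qed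
  \<comment> \<open>Only translates by indices in the finite set \<open>N\<close> can carry a point of the cell into the shifted cell.\<close>
  define N where "N = {m. \<forall>i. \<bar>of_int (m i) - M a $ i\<bar> \<le> 1}"
  have fin: "finite N"
  proof (rule finite_subset)
    show "N \<subseteq> Pi\<^sub>E UNIV (\<lambda>i. {\<lceil>M a $ i - 1\<rceil>..\<lfloor>M a $ i + 1\<rfloor>})"
    proof
      fix m assume m: "m \<in> N"
      have "\<lceil>M a $ i - 1\<rceil> \<le> m i \<and> m i \<le> \<lfloor>M a $ i + 1\<rfloor>" for i
      proof -
        have "\<bar>of_int (m i) - M a $ i\<bar> \<le> 1" using m by (simp add: N_def)
        then show ?thesis by linarith
      qed
      then show "m \<in> Pi\<^sub>E UNIV (\<lambda>i. {\<lceil>M a $ i - 1\<rceil>..\<lfloor>M a $ i + 1\<rfloor>})" by (simp add: PiE_iff)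
    qed
    show "finite (Pi\<^sub>E (UNIV::'n set) (\<lambda>i. {\<lceil>M a $ i - 1\<rceil>..\<lfloor>M a $ i + 1\<rfloor>}))"
      by (intro finite_PiE) auto
  qed
  have "norm (f (x + lattice_pt m)) \<le> indicator N m" if "x \<in> cell" for x m
  proof (cases "x + lattice_pt m - a \<in> cell")
    case True
    have "\<bar>of_int (m i) - M a $ i\<bar> \<le> 1" for i
    proof -
      have "0 \<le> M x $ i" "M x $ i < 1" using that by (auto simp: cell_def)
      moreover have "0 \<le> M x $ i + of_int (m i) - M a $ i" "M x $ i + of_int (m i) - M a $ i < 1"
        using True by (auto simp: cell_def M_add M_diff M_pt)
      ultimately show ?thesis by linarith
    qed
    then have "m \<in> N" by (simp add: N_def)
    then show ?thesis using True by (simp add: f_def)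
  qed (simp add: f_def)
  moreover have "(indicator N :: _ \<Rightarrow> real) summable_on UNIV"
    using summable_on_finite[OF fin, of "indicator N :: _ \<Rightarrow> real"]
    by (rule summable_on_cong_neutral[THEN iffD1, rotated -1]) auto
  ultimately have "(LINT x|lborel. f x) = (LINT x:cell|lborel. (\<Sum>\<^sub>\<infinity>m. f (x + lattice_pt m)))"
    by (intro unfold_integral(2)) auto
  also have "\<dots> = ?I" by (simp add: tile)
  finally have 1: "(LINT x|lborel. f x) = ?I" .
  have "(LINT x|lborel. f x) = (LINT x|lborel. f (x + a))"
    by (simp add: lborel_integral_shift)
  also have "\<dots> = (LINT x|lborel. - (indicator cell x *\<^sub>R character k x))"
    by (simp add: f_def character_plus character_a)
  also have "\<dots> = - ?I" by (simp add: set_lebesgue_integral_def)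
  finally have "?I = 0" using 1 by simp
  then show ?thesis using False by simp
qed

section \<open>Periodic functions are determined by their Fourier coefficients\<close>

text \<open>Trigonometric polynomials, that is, the complex span of the characters.\<close>

inductive trig :: "(real ^ 'n \<Rightarrow> complex) \<Rightarrow> bool" where
  trig_character: "trig (character k)"
| trig_scale: "trig q \<Longrightarrow> trig (\<lambda>x. c * q x)"
| trig_add: "trig p \<Longrightarrow> trig q \<Longrightarrow> trig (\<lambda>x. p x + q x)"

lemma trig_const: "trig (\<lambda>x. c)"
  using trig_scale[OF trig_character[of "\<lambda>_. 0"], of c] by simp

lemma trig_character_mult: "trig q \<Longrightarrow> trig (\<lambda>x. character k x * q x)"
proof (induction rule: trig.induct)
  case (trig_character l)
  then show ?case by (simp add: character_mult trig.trig_character)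
next
  case (trig_scale q c)
  then show ?case using trig.trig_scale[of "\<lambda>x. character k x * q x" c] by (simp add: mult_ac)
next
  case (trig_add p q)
  then show ?case using trig.trig_add by (simp add: distrib_left)
qed

lemma trig_mult: "trig p \<Longrightarrow> trig q \<Longrightarrow> trig (\<lambda>x. p x * q x)"
proof (induction rule: trig.induct)
  case (trig_character l)
  then show ?case by (rule trig_character_mult)
next
  case (trig_scale p c)
  then show ?case using trig.trig_scale[of "\<lambda>x. p x * q x" c] by (simp add: mult_ac)
next
  case (trig_add p1 p2)
  then show ?case using trig.trig_add by (simp add: distrib_right)
qed

lemma continuous_on_trig: "trig q \<Longrightarrow> continuous_on S q"
  by (induction rule: trig.induct) (auto intro!: continuous_intros continuous_on_character)

text \<open>The quotient of the space by the lattice, embedded into \<open>\<complex>^n\<close>: two points have the same image iff they differ by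
a lattice point. Stone-Weierstrass needs a compact space whose points are separated, which the image is and
the fundamental cell is not.\<close>

definition torus :: "real ^ 'n \<Rightarrow> complex ^ 'n" where
  "torus x = (\<chi> i. cis (2 * pi * M x $ i))"

lemma torus_eqD:
  assumes "torus x = torus y"
  shows "\<exists>m. y = x + lattice_pt m"
proof -
  have "\<exists>n::int. M y $ i = M x $ i + of_int n" for i
  proof -
    have "cis (2 * pi * M y $ i) = cis (2 * pi * M x $ i)"
      using assms by (simp add: torus_def vec_eq_iff)
    then have "sin (2 * pi * M y $ i) = sin (2 * pi * M x $ i) \<and> cos (2 * pi * M y $ i) = cos (2 * pi * M x $ i)"
      by (simp add: complex_eq_iff)
    then obtain n :: int where "2 * pi * M y $ i = 2 * pi * M x $ i + 2 * pi * of_int n"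
      by (subst (asm) sin_cos_eq_iff) auto
    then have "2 * pi * (M y $ i - (M x $ i + of_int n)) = 0" by (simp add: algebra_simps)
    then show ?thesis by (intro exI[of _ n]) simp
  qed
  then obtain m where m: "\<And>i. M y $ i = M x $ i + of_int (m i)" by metis
  have "M y = M (x + lattice_pt m)" by (simp add: vec_eq_iff M_add M_pt m)
  then show ?thesis using L_M by metis
qed

lemma continuous_on_torus: "continuous_on S torus"
  unfolding torus_def cis_conv_exp
  by (intro continuous_intros continuous_on_M)

lemma shift_into_cell: "\<exists>m. x + lattice_pt m \<in> cell"
  by (simp add: in_cell_shift_iff)

lemma torus_shift: "torus (x + lattice_pt m) = torus x"
proof -
  have "cis (2 * pi * M x $ i + 2 * pi * of_int (m i)) = cis (2 * pi * M x $ i)" for i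
    by (simp add: cis_mult[symmetric] cis_multiple_2pi)
  then show ?thesis by (simp add: torus_def vec_eq_iff M_add M_pt distrib_left)
qed

lemma range_torus: "range torus = torus ` closed_cell"
proof (intro equalityI subsetI)
  fix z assume "z \<in> range torus"
  then obtain x where "z = torus x" by blast
  then show "z \<in> torus ` closed_cell"
    using shift_into_cell[of x] cell_subset torus_shift by (metis image_eqI subsetD)
qed auto

text \<open>A continuous periodic function descends to a continuous function \<open>G\<close> on the torus, because the closed cell is
compact and maps onto the torus. The real and imaginary parts of the torus coordinates separate points and are
trigonometric polynomials, so Stone-Weierstrass applies to \<open>G\<close>.\<close>

lemma trig_approx:
  fixes h :: "real ^ 'n \<Rightarrow> real"
  assumes cont: "continuous_on UNIV h" and per: "\<And>x m. h (x + lattice_pt m) = h x" and e: "0 < e"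
  shows "\<exists>q. trig (\<lambda>x. of_real (q x)) \<and> (\<forall>x. \<bar>h x - q x\<bar> < e)"
proof -
  define G where "G z = h (SOME x. torus x = z)" for z
  have G: "G (torus x) = h x" for x
  proof -
    have "torus (SOME y. torus y = torus x) = torus x" by (rule someI) (rule refl)
    then show ?thesis unfolding G_def using torus_eqD per by metis
  qed
  have "continuous_on (range torus) G"
    unfolding continuous_on_closed_invariant
  proof (intro allI impI)
    fix B :: "real set" assume "closed B"
    then have "closed (h -` B)"
      using cont by (metis continuous_closed_vimage continuous_on_eq_continuous_at open_UNIV UNIV_I)
    then have "compact (closed_cell \<inter> h -` B)"
      by (intro compact_Int_closed compact_closed_cell)
    then have "compact (torus ` (closed_cell \<inter> h -` B))"
      by (intro compact_continuous_image continuous_on_torus)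
    moreover have "torus ` (closed_cell \<inter> h -` B) \<inter> range torus = G -` B \<inter> range torus"
      unfolding range_torus using G by (auto intro!: imageI)
    ultimately show "\<exists>A. closed A \<and> A \<inter> range torus = G -` B \<inter> range torus"
      using compact_imp_closed by blast
  qed
  moreover define R where "R = {g. continuous_on (range torus) g \<and> trig (\<lambda>x. of_real (g (torus x)))}"
  have coord: "trig (\<lambda>x. of_real (Re (torus x $ i)))" "trig (\<lambda>x. of_real (Im (torus x $ i)))" for i
  proof -
    define d :: "'n \<Rightarrow> int" where "d j = (if j = i then 1 else 0)" for j
    have "(\<Sum>j\<in>UNIV. of_int (d j) * M x $ j) = M x $ i" for x
      by (simp add: d_def if_distrib[of "\<lambda>c. c * _"] if_distrib[of of_int] cong: if_cong)
    then have char_d: "character d x = torus x $ i" "character (\<lambda>j. - d j) x = cnj (torus x $ i)" for x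
      by (simp_all add: character_uminus) (simp_all add: character_def torus_def)
    have "trig (\<lambda>x. 1/2 * character d x + 1/2 * character (\<lambda>j. - d j) x)"
      by (intro trig.intros)
    moreover have "of_real (Re z) = 1/2 * z + 1/2 * cnj z" for z by (simp add: complex_eq_iff)
    ultimately show "trig (\<lambda>x. of_real (Re (torus x $ i)))" by (simp add: char_d)
    have "trig (\<lambda>x. (- \<i>/2) * character d x + (\<i>/2) * character (\<lambda>j. - d j) x)"
      by (intro trig.intros)
    moreover have "of_real (Im z) = (- \<i>/2) * z + (\<i>/2) * cnj z" for z by (simp add: complex_eq_iff)
    ultimately show "trig (\<lambda>x. of_real (Im (torus x $ i)))" by (simp add: char_d)
  qed
  have "function_ring_on R (range torus)"
  proof (rule function_ring_on.intro)
    show "compact (range torus)" unfolding range_torus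
      by (intro compact_continuous_image continuous_on_torus compact_closed_cell)
  next
    fix z w assume "z \<noteq> (w :: complex ^ 'n)"
    then obtain i where i: "Re (z $ i) \<noteq> Re (w $ i) \<or> Im (z $ i) \<noteq> Im (w $ i)"
      by (auto simp: vec_eq_iff complex_eq_iff)
    have "(\<lambda>z. Re (z $ i)) \<in> R" "(\<lambda>z. Im (z $ i)) \<in> R"
      using coord by (auto simp: R_def intro!: continuous_intros)
    with i show "\<exists>f\<in>R. f z \<noteq> f w"
      by (elim disjE) (erule (1) bexI[rotated])+
  next
    fix p q assume "p \<in> R" "q \<in> R"
    then show "(\<lambda>z. p z + q z) \<in> R" "(\<lambda>z. p z * q z) \<in> R"
      unfolding R_def
      by (simp_all add: continuous_on_add continuous_on_mult trig_add trig_mult)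
  qed (simp_all add: R_def trig_const)
  ultimately obtain g where "g \<in> R" "\<forall>z\<in>range torus. \<bar>G z - g z\<bar> < e"
    using function_ring_on.Stone_Weierstrass_basic[of R "range torus" G e] e by blast
  then show ?thesis
    by (intro exI[of _ "\<lambda>x. g (torus x)"]) (simp add: R_def G)
qed

lemma bounded_on_cell:
  fixes h :: "real ^ 'n \<Rightarrow> complex"
  assumes "continuous_on UNIV h"
  obtains B where "0 \<le> B" "\<And>x. x \<in> cell \<Longrightarrow> norm (h x) \<le> B"
proof -
  have "compact (h ` closed_cell)"
    using assms by (intro compact_continuous_image compact_closed_cell) (rule continuous_on_subset, auto)
  then obtain B where "\<forall>y\<in>h ` closed_cell. norm y \<le> B"
    using compact_imp_bounded bounded_iff by metis
  then show ?thesis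
    using that[of "max 0 B"] cell_subset by (meson imageI le_max_iff_disj max.cobounded1 subsetD)
qed

lemma set_integrable_cell:
  fixes h :: "real ^ 'n \<Rightarrow> complex"
  assumes "continuous_on UNIV h"
  shows "set_integrable lborel cell h"
  using bounded_on_cell[OF assms] set_integrable_cell_bounded(1)[of h]
    borel_measurable_continuous_onI[OF assms] by metis

text \<open>The translates of the cell are countably many and cover the space, so \<open>h\<close> vanishes almost everywhere on the whole
space, and continuity removes the exceptional null set.\<close>

lemma periodic_eq_0_if_AE:
  fixes h :: "real ^ 'n \<Rightarrow> real"
  assumes cont: "continuous_on UNIV h" and per: "\<And>x m. h (x + lattice_pt m) = h x"
    and ae: "AE x in lborel. x \<in> cell \<longrightarrow> h x = 0"
  shows "h x = 0"
proof (rule continuous_AE_zero[OF cont])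
  have "closed (h -` {0})"
    using cont by (intro continuous_closed_vimage) (auto simp: continuous_on_eq_continuous_at)
  then have "- cell \<union> h -` {0} \<in> sets borel"
    by (intro sets.Un borel_closed borel_comp cell_borel)
  also have "- cell \<union> h -` {0} = {x. x \<in> cell \<longrightarrow> h x = 0}" by auto
  finally have sets: "{x. x \<in> cell \<longrightarrow> h x = 0} \<in> sets borel" .
  have "AE x in lborel. x + lattice_pt m \<in> cell \<longrightarrow> h x = 0" for m
  proof -
    have "AE x in distr lborel borel ((+) (lattice_pt m)). x \<in> cell \<longrightarrow> h x = 0"
      unfolding lborel_distr_plus by (rule ae)
    then have "AE x in lborel. lattice_pt m + x \<in> cell \<longrightarrow> h (lattice_pt m + x) = 0"
      using sets by (subst (asm) AE_distr_iff) auto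
    then show ?thesis by (simp add: add.commute[of "lattice_pt m"] per)
  qed
  then have "AE x in lborel. \<forall>m. x + lattice_pt m \<in> cell \<longrightarrow> h x = 0"
    by (subst AE_all_countable) auto
  then show "AE x in lborel. h x = 0"
    using shift_into_cell by (auto elim!: eventually_mono)
qed

text \<open>The integral of \<open>h^2\<close> over the cell equals that of \<open>h (h - q)\<close> for every real trigonometric polynomial \<open>q\<close>; choosing
\<open>q\<close> uniformly close to \<open>h\<close> shows that it is zero.\<close>

lemma periodic_real_eq_0:
  fixes h :: "real ^ 'n \<Rightarrow> real"
  assumes cont: "continuous_on UNIV h" and per: "\<And>x m. h (x + lattice_pt m) = h x"
    and orth: "\<And>q. trig (\<lambda>x. of_real (q x)) \<Longrightarrow>
                (LINT x:cell|lborel. of_real (h x) * complex_of_real (q x)) = 0"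
  shows "h x = 0"
proof -
  let ?I = "\<lambda>u::real^'n \<Rightarrow> complex. LINT x:cell|lborel. u x"
  have hc: "continuous_on UNIV (\<lambda>x. complex_of_real (h x))"
    by (intro continuous_intros cont)
  obtain B where B: "0 \<le> B" "\<And>x. x \<in> cell \<Longrightarrow> norm (complex_of_real (h x)) \<le> B"
    using bounded_on_cell[OF hc] by metis
  have hh: "set_integrable lborel cell (\<lambda>x. complex_of_real (h x) * of_real (h x))"
    by (intro set_integrable_cell continuous_intros cont)
  have small: "norm (?I (\<lambda>x. of_real (h x) * of_real (h x))) \<le> covolume * (B * e)" if e: "0 < e" for e
  proof -
    obtain q where q: "trig (\<lambda>x. of_real (q x))" "\<And>x. \<bar>h x - q x\<bar> < e"
      using trig_approx[OF cont per e] by blast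
    have qc: "continuous_on UNIV (\<lambda>x. complex_of_real (q x))"
      by (rule continuous_on_trig[OF q(1)])
    have "?I (\<lambda>x. of_real (h x) * of_real (h x))
        = ?I (\<lambda>x. of_real (h x) * of_real (h x)) - ?I (\<lambda>x. of_real (h x) * of_real (q x))"
      using orth[OF q(1)] by simp
    also have "\<dots> = ?I (\<lambda>x. of_real (h x) * of_real (h x) - of_real (h x) * of_real (q x))"
      by (intro set_integral_diff(2)[symmetric] hh set_integrable_cell continuous_intros hc qc)
    also have "\<dots> = ?I (\<lambda>x. of_real (h x) * (of_real (h x) - of_real (q x)))"
      by (simp add: right_diff_distrib)
    also have "norm \<dots> \<le> (LINT x|lborel. norm (indicator cell x *\<^sub>R (of_real (h x) * (complex_of_real (h x) - of_real (q x)))))"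
      unfolding set_lebesgue_integral_def by (rule integral_norm_bound)
    also have "\<dots> \<le> covolume * (B * e)"
    proof (rule set_integrable_cell_bounded(2))
      show "(\<lambda>x. of_real (h x) * (complex_of_real (h x) - of_real (q x))) \<in> borel_measurable borel"
        by (intro borel_measurable_continuous_onI continuous_intros hc qc)
      fix x assume "x \<in> cell"
      then have "\<bar>h x\<bar> * \<bar>h x - q x\<bar> \<le> B * e"
        using B q(2)[of x] by (intro mult_mono) (auto simp: less_imp_le)
      then show "norm (of_real (h x) * (complex_of_real (h x) - of_real (q x))) \<le> B * e"
        by (simp add: norm_mult flip: of_real_diff)
    qed
    finally show ?thesis .
  qed
  have pos: "0 < covolume * B + 1"
    using B(1) covolume_pos by (simp add: add_nonneg_pos)
  define c where "c = norm (?I (\<lambda>x. of_real (h x) * of_real (h x)))"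
  have "c / (covolume * B + 1) \<le> 0 + e" if "0 < e" for e
  proof -
    have "c \<le> covolume * (B * e)" unfolding c_def using that by (rule small)
    also have "\<dots> \<le> (covolume * B + 1) * e" using that by (simp add: algebra_simps)
    finally show ?thesis using pos by (simp add: divide_le_eq mult_ac)
  qed
  then have "c / (covolume * B + 1) \<le> 0" by (rule field_le_epsilon)
  then have "c \<le> 0" using pos by (simp add: divide_le_0_iff)
  then have "?I (\<lambda>x. of_real (h x) * of_real (h x)) = 0"
    by (simp add: c_def)
  then have "(LINT x|lborel. complex_of_real (indicator cell x * (h x * h x))) = 0"
    by (simp add: set_lebesgue_integral_def scaleR_conv_of_real)
  then have z: "(LINT x|lborel. indicator cell x * (h x * h x)) = 0"
    by (metis integral_complex_of_real of_real_eq_0_iff)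
  have "integrable lborel (\<lambda>x. complex_of_real (indicator cell x * (h x * h x)))"
    using hh by (simp add: set_integrable_def scaleR_conv_of_real)
  then have "integrable lborel (\<lambda>x. indicator cell x * (h x * h x))"
    by (rule complex_of_real_integrable_eq[THEN iffD1])
  then have "AE x in lborel. indicator cell x * (h x * h x) = 0"
    using z by (subst (asm) integral_nonneg_eq_0_iff_AE) auto
  then have "AE x in lborel. x \<in> cell \<longrightarrow> h x = 0"
    by (rule eventually_mono) auto
  then show ?thesis using periodic_eq_0_if_AE[of h x] cont per by blast
qed

lemma fourier_coeffs_unique:
  fixes h :: "real ^ 'n \<Rightarrow> complex"
  assumes cont: "continuous_on UNIV h" and per: "\<And>x m. h (x + lattice_pt m) = h x"
    and coeff: "\<And>k. (LINT x:cell|lborel. h x * character k x) = 0"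
  shows "h x = 0"
proof -
  have int: "set_integrable lborel cell (\<lambda>x. h x * q x)" if "trig q" for q
    by (rule set_integrable_cell) (rule continuous_on_mult[OF cont continuous_on_trig[OF that]])
  have orth: "(LINT x:cell|lborel. h x * q x) = 0" if "trig q" for q
    using that
  proof (induction rule: trig.induct)
    case (trig_scale q c)
    then show ?case using set_integral_mult_right[of lborel cell c "\<lambda>x. h x * q x"]
      by (simp add: mult_ac)
  next
    case (trig_add p q)
    then show ?case using set_integral_add(2)[OF int[of p] int[of q]] by (simp add: distrib_left)
  qed (rule coeff)
  have parts: "(LINT x:cell|lborel. of_real (Re (h x)) * complex_of_real (q x)) = 0"
     "(LINT x:cell|lborel. of_real (Im (h x)) * complex_of_real (q x)) = 0"
    if q: "trig (\<lambda>x. of_real (q x))" for q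
  proof -
    have i: "integrable lborel (\<lambda>x. indicator cell x *\<^sub>R (h x * complex_of_real (q x)))"
      using int[OF q] by (simp add: set_integrable_def)
    have "(LINT x|lborel. indicator cell x * (Re (h x) * q x)) = 0"
      using integral_Re[OF i] orth[OF q] by (simp add: set_lebesgue_integral_def)
    then show "(LINT x:cell|lborel. of_real (Re (h x)) * complex_of_real (q x)) = 0"
      using integral_complex_of_real[of lborel "\<lambda>x. indicator cell x * (Re (h x) * q x)"]
      by (simp add: set_lebesgue_integral_def scaleR_conv_of_real)
    have "(LINT x|lborel. indicator cell x * (Im (h x) * q x)) = 0"
      using integral_Im[OF i] orth[OF q] by (simp add: set_lebesgue_integral_def)
    then show "(LINT x:cell|lborel. of_real (Im (h x)) * complex_of_real (q x)) = 0"
      using integral_complex_of_real[of lborel "\<lambda>x. indicator cell x * (Im (h x) * q x)"]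
      by (simp add: set_lebesgue_integral_def scaleR_conv_of_real)
  qed
  have "Re (h x) = 0"
    using per parts by (intro periodic_real_eq_0[of "\<lambda>x. Re (h x)" x] continuous_intros cont) auto
  moreover have "Im (h x) = 0"
    using per parts by (intro periodic_real_eq_0[of "\<lambda>x. Im (h x)" x] continuous_intros cont) auto
  ultimately show ?thesis by (simp add: complex_eq_iff)
qed

section \<open>Poisson summation\<close>

text \<open>The value of the Fourier transform of \<open>f\<close> at the dual lattice vector with index \<open>k\<close>; the identification is
\<open>hat_eq_fourier\<close> below.\<close>

definition hat :: "(real ^ 'n \<Rightarrow> real) \<Rightarrow> ('n \<Rightarrow> int) \<Rightarrow> complex" where
  "hat f k = (LINT y|lborel. of_real (f y) * cnj (character k y))"

lemma lattice_pt_plus: "lattice_pt (\<lambda>i. l i + m i) = lattice_pt l + lattice_pt m"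
proof -
  have "(\<chi> i. real_of_int (l i + m i)) = (\<chi> i. real_of_int (l i)) + (\<chi> i. real_of_int (m i))"
    by (simp add: vec_eq_iff)
  then show ?thesis unfolding lattice_pt_def using linear_L by (simp add: linear_add)
qed

text \<open>Let \<open>P\<close> be the sum over the lattice and \<open>Q\<close> the dual series. Both are continuous and periodic; for \<open>P\<close>, majorants that
are uniform on balls give continuity. Unfolding the integral over the cell gives the Fourier coefficients of
\<open>P\<close>, and orthogonality of characters gives those of \<open>Q\<close>: the latter are \<open>covolume\<close> times the former.\<close>

theorem poisson_summation:
  fixes f :: "real ^ 'n \<Rightarrow> real"
  assumes cont: "continuous_on UNIV f"
    and bound: "\<And>R. \<exists>B. B summable_on UNIV \<and> (\<forall>m. \<forall>x\<in>cball 0 R. \<bar>f (x + lattice_pt m)\<bar> \<le> B m)"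
    and hat: "(\<lambda>k. norm (hat f k)) summable_on UNIV"
  shows "of_real covolume * (\<Sum>\<^sub>\<infinity>m. complex_of_real (f (x + lattice_pt m))) = (\<Sum>\<^sub>\<infinity>k. hat f k * character k x)"
proof -
  define P where "P x = (\<Sum>\<^sub>\<infinity>m. complex_of_real (f (x + lattice_pt m)))" for x
  define Q where "Q x = (\<Sum>\<^sub>\<infinity>k. hat f k * character k x)" for x
  have fc: "continuous_on S (\<lambda>x. complex_of_real (f x))" for S
    by (intro continuous_on_of_real continuous_on_subset[OF cont]) auto
  have contP: "continuous_on UNIV P"
    unfolding continuous_on_eq_continuous_at[OF open_UNIV]
  proof
    fix x :: "real ^ 'n"
    obtain B where B: "B summable_on UNIV" "\<And>m y. y \<in> cball 0 (norm x + 1) \<Longrightarrow> \<bar>f (y + lattice_pt m)\<bar> \<le> B m"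
      using bound[of "norm x + 1"] by blast
    have "continuous_on (ball 0 (norm x + 1)) P"
      unfolding P_def using B(2)
      by (intro continuous_on_infsum[OF _ _ B(1)] continuous_on_compose2[OF fc] continuous_intros) auto
    then show "isCont P x" by (rule continuous_on_interior) simp
  qed
  have contQ: "continuous_on UNIV Q"
    unfolding Q_def
    by (rule continuous_on_infsum[OF _ _ hat]) (auto intro!: continuous_intros continuous_on_character simp: norm_mult)
  have perP: "P (x + lattice_pt l) = P x" for x l
  proof -
    have "bij_betw (\<lambda>m i. l i + m i) UNIV UNIV"
      by (rule bij_betw_byWitness[where f' = "\<lambda>m i. m i - l i"]) auto
    then have "(\<Sum>\<^sub>\<infinity>m. complex_of_real (f (x + lattice_pt (\<lambda>i. l i + m i)))) = (\<Sum>\<^sub>\<infinity>m. complex_of_real (f (x + lattice_pt m)))"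
      by (rule infsum_reindex_bij_betw)
    then show ?thesis by (simp add: P_def lattice_pt_plus add.assoc)
  qed
  obtain R where R: "closed_cell \<subseteq> cball 0 R"
    using compact_imp_bounded[OF compact_closed_cell] unfolding bounded_iff by (auto simp: subset_iff)
  obtain B where B: "B summable_on UNIV" "\<And>m y. y \<in> cball 0 R \<Longrightarrow> \<bar>f (y + lattice_pt m)\<bar> \<le> B m"
    using bound[of R] by blast
  have P_coeff: "(LINT x:cell|lborel. P x * character l x) = hat f (\<lambda>i. - l i)" for l
  proof -
    have "P x * character l x = (\<Sum>\<^sub>\<infinity>m. of_real (f (x + lattice_pt m)) * character l (x + lattice_pt m))" for x
      unfolding P_def by (simp add: character_plus infsum_cmult_left')
    moreover have "(LINT x|lborel. of_real (f x) * character l x)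
        = (LINT x:cell|lborel. (\<Sum>\<^sub>\<infinity>m. of_real (f (x + lattice_pt m)) * character l (x + lattice_pt m)))"
    proof (rule unfold_integral(2)[OF _ _ B(1)])
      show "(\<lambda>x. of_real (f x) * character l x) \<in> borel_measurable borel"
        by (intro borel_measurable_continuous_onI continuous_intros fc continuous_on_character)
      show "norm (of_real (f (x + lattice_pt m)) * character l (x + lattice_pt m)) \<le> B m" if "x \<in> cell" for x m
        using that cell_subset R B(2)[of x m] by (auto simp: norm_mult)
    qed
    ultimately show ?thesis by (simp add: hat_def character_uminus)
  qed
  have Q_coeff: "(LINT x:cell|lborel. Q x * character l x) = of_real covolume * hat f (\<lambda>i. - l i)" for l
  proof -
    define g where "g k x = indicator cell x *\<^sub>R (hat f k * character (\<lambda>i. k i + l i) x)" for k x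
    have "norm (g k x) \<le> norm (hat f k)" for k x by (simp add: g_def norm_mult indicator_def)
    then have 1: "(\<lambda>k. norm (g k x)) summable_on UNIV" for x
      by (intro Infinite_Sum.abs_summable_on_comparison_test'[OF hat])
    have meas: "(\<lambda>x. hat f k * character (\<lambda>i. k i + l i) x) \<in> borel_measurable borel" for k
      by (intro borel_measurable_continuous_onI continuous_intros continuous_on_character)
    have 2: "integrable lborel (g k)" "(LINT x|lborel. norm (g k x)) \<le> covolume * norm (hat f k)" for k
      using set_integrable_cell_bounded[OF meas[of k], of "norm (hat f k)"]
      unfolding g_def set_integrable_def by (simp_all add: norm_mult)
    have 3: "(\<lambda>k. LINT x|lborel. norm (g k x)) summable_on UNIV"
      by (rule summable_on_comparison_test[OF summable_on_cmult_right[OF hat, of covolume]]) (simp_all add: 2)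
    have gint: "(LINT x|lborel. g k x) = (if k = (\<lambda>i. - l i) then hat f k * of_real covolume else 0)" for k
    proof -
      have "(LINT x|lborel. g k x) = hat f k * (LINT x:cell|lborel. character (\<lambda>i. k i + l i) x)"
        unfolding g_def by (simp add: set_lebesgue_integral_def flip: integral_mult_right_zero mult_scaleR_right)
      then show ?thesis by (auto simp: integral_character_cell fun_eq_iff add_eq_0_iff2)
    qed
    have "Q x * character l x = (\<Sum>\<^sub>\<infinity>k. hat f k * character (\<lambda>i. k i + l i) x)" for x
      unfolding Q_def by (simp add: infsum_cmult_left'[symmetric] character_mult[symmetric] mult.assoc)
    then have "indicator cell x *\<^sub>R (Q x * character l x) = (\<Sum>\<^sub>\<infinity>k. g k x)" for x
      by (auto simp: g_def indicator_def)
    then have "(LINT x:cell|lborel. Q x * character l x) = (LINT x|lborel. (\<Sum>\<^sub>\<infinity>k. g k x))"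
      by (simp add: set_lebesgue_integral_def)
    also have "\<dots> = (\<Sum>\<^sub>\<infinity>k. LINT x|lborel. g k x)"
      by (rule integral_infsum(2)[OF infinite_UNIV_fun_int 2(1) 1 3])
    also have "\<dots> = (\<Sum>\<^sub>\<infinity>k. if k = (\<lambda>i. - l i) then hat f k * of_real covolume else 0)"
      by (simp add: gint)
    also have "\<dots> = (\<Sum>\<^sub>\<infinity>k\<in>{\<lambda>i. - l i}. hat f k * of_real covolume)"
      by (rule infsum_cong_neutral) auto
    finally show ?thesis by (simp add: mult.commute)
  qed
  have "of_real covolume * P x - Q x = 0"
  proof (rule fourier_coeffs_unique)
    show "continuous_on UNIV (\<lambda>x. of_real covolume * P x - Q x)"
      by (intro continuous_intros contP contQ)
    show "of_real covolume * P (x + lattice_pt m) - Q (x + lattice_pt m) = of_real covolume * P x - Q x" for x m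
      by (simp add: perP Q_def character_plus)
    show "(LINT x:cell|lborel. (of_real covolume * P x - Q x) * character k x) = 0" for k
    proof -
      have "(LINT x:cell|lborel. (of_real covolume * P x - Q x) * character k x)
          = (LINT x:cell|lborel. of_real covolume * (P x * character k x)) - (LINT x:cell|lborel. Q x * character k x)"
        unfolding left_diff_distrib mult.assoc
        by (intro set_integral_diff(2) set_integrable_cell continuous_intros contP contQ continuous_on_character)
      then show ?thesis by (simp add: P_coeff Q_coeff)
    qed
  qed
  then show ?thesis by (simp add: P_def Q_def)
qed

section \<open>Dilating a lattice sum\<close>

text \<open>For \<open>x\<close> in a fixed ball, each \<open>1 + |m i|\<close> is at most a constant times \<open>1 + norm (x + lattice_pt m)\<close>. Raising this
to the power \<open>s = 1 + \<delta> / n\<close> and multiplying over the \<open>n\<close> coordinates bounds the decay rate by a summable product.\<close>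

lemma lattice_values_bounded:
  fixes f :: "real ^ 'n \<Rightarrow> real"
  assumes decay: "\<And>x. \<bar>f x\<bar> \<le> C * (1 + norm x) powr (- real CARD('n) - \<delta>)" and "0 < \<delta>"
  shows "\<exists>B. B summable_on UNIV \<and> (\<forall>m. \<forall>x\<in>cball 0 R. \<bar>f (x + lattice_pt m)\<bar> \<le> B m)"
proof -
  define s where "s = 1 + \<delta> / CARD('n)"
  have s: "1 < s" using \<open>0 < \<delta>\<close> by (simp add: s_def)
  have ns: "CARD('n) + \<delta> = s * CARD('n)" "- real CARD('n) - \<delta> = - (s * CARD('n))"
    by (simp_all add: s_def distrib_right)
  obtain K where K: "0 < K" "\<And>x. norm (M x) \<le> norm x * K"
    using bounded_linear.pos_bounded linear_M linear_conv_bounded_linear by blast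
  define D where "D = (1 + \<bar>R\<bar>) * (1 + K)"
  have D: "0 < D" using K(1) by (simp add: D_def)
  have C: "0 \<le> C" using order_trans[OF abs_ge_zero decay[of 0]] by simp
  define B where "B m = C * D powr (CARD('n) + \<delta>) * (\<Prod>i\<in>UNIV. (1 + real_of_int \<bar>m i\<bar>) powr (- s))"
    for m :: "'n \<Rightarrow> int"
  have "B summable_on UNIV"
    unfolding B_def by (intro summable_on_cmult_right summable_on_prod_int_powr s)
  moreover have "\<bar>f (x + lattice_pt m)\<bar> \<le> B m" if x: "x \<in> cball 0 R" for x m
  proof -
    let ?N = "1 + norm (x + lattice_pt m)"
    have N: "0 < ?N" by (simp add: add_pos_nonneg)
    have coord: "1 + real_of_int \<bar>m i\<bar> \<le> D * ?N" for i
    proof -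
      have "real_of_int \<bar>m i\<bar> = \<bar>M (lattice_pt m) $ i\<bar>" by (simp add: M_pt)
      also have "\<dots> \<le> norm (M (lattice_pt m))" by (rule component_le_norm_cart)
      also have "\<dots> \<le> norm (lattice_pt m) * K" by (rule K)
      finally have "1 + real_of_int \<bar>m i\<bar> \<le> (1 + norm (lattice_pt m)) * (1 + K)"
        using K(1) norm_ge_zero[of "lattice_pt m"] unfolding ring_distribs by linarith
      also have "1 + norm (lattice_pt m) \<le> (1 + \<bar>R\<bar>) * ?N"
      proof -
        have "norm (lattice_pt m) \<le> norm (x + lattice_pt m) + norm x"
          using norm_triangle_ineq4[of "x + lattice_pt m" x] by simp
        also have "norm x \<le> \<bar>R\<bar>" using x by simp
        moreover have "0 \<le> \<bar>R\<bar> * norm (x + lattice_pt m)" by simp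
        ultimately show ?thesis unfolding ring_distribs by linarith
      qed
      then have "(1 + norm (lattice_pt m)) * (1 + K) \<le> (1 + \<bar>R\<bar>) * ?N * (1 + K)"
        using K(1) by (intro mult_right_mono) auto
      finally show ?thesis by (simp add: D_def mult_ac)
    qed
    have "?N powr (- real CARD('n) - \<delta>) = (\<Prod>i\<in>(UNIV::'n set). ?N powr (- s))"
      unfolding ns using N by (simp add: powr_power mult.commute)
    also have "\<dots> \<le> (\<Prod>i\<in>UNIV. D powr s * (1 + real_of_int \<bar>m i\<bar>) powr (- s))"
    proof (intro prod_mono conjI)
      fix i
      have "(1 + real_of_int \<bar>m i\<bar>) powr s \<le> (D * ?N) powr s"
        using coord[of i] s by (intro powr_mono2) auto
      also have "\<dots> = D powr s * ?N powr s" using D N by (simp add: powr_mult)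
      finally show "?N powr (- s) \<le> D powr s * (1 + real_of_int \<bar>m i\<bar>) powr (- s)"
        using N by (simp add: powr_minus field_simps)
    qed simp
    also have "\<dots> = D powr (CARD('n) + \<delta>) * (\<Prod>i\<in>UNIV. (1 + real_of_int \<bar>m i\<bar>) powr (- s))"
      unfolding ns using D by (simp add: prod.distrib powr_power mult.commute)
    finally have "C * ?N powr (- real CARD('n) - \<delta>) \<le> B m"
      using C by (simp add: B_def mult_left_mono mult.assoc)
    then show ?thesis using decay[of "x + lattice_pt m"] by linarith
  qed
  ultimately show ?thesis by blast
qed

lemma summable_lattice_values:
  fixes f :: "real ^ 'n \<Rightarrow> real"
  assumes decay: "\<And>x. \<bar>f x\<bar> \<le> C * (1 + norm x) powr (- real CARD('n) - \<delta>)" and "0 < \<delta>"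
  shows "(\<lambda>m. f (x + lattice_pt m)) summable_on UNIV"
proof -
  obtain B where B: "B summable_on UNIV" "\<And>m y. y \<in> cball 0 (norm x) \<Longrightarrow> \<bar>f (y + lattice_pt m)\<bar> \<le> B m"
    using lattice_values_bounded[OF assms, of "norm x"] by blast
  have "(\<lambda>m. norm (f (x + lattice_pt m))) summable_on UNIV"
    by (rule Infinite_Sum.abs_summable_on_comparison_test'[OF B(1)]) (simp add: B(2))
  then show ?thesis by (rule abs_summable_summable)
qed

text \<open>The dual lattice is the image of \<open>\<int>^n\<close> under the adjoint of \<open>M\<close> (see \<open>dual_lattice_eq\<close>).\<close>

definition freq :: "('n \<Rightarrow> int) \<Rightarrow> real ^ 'n" where
  "freq k = adjoint M (\<chi> i. of_int (k i))"

lemma inner_freq: "y \<bullet> freq k = (\<Sum>i\<in>UNIV. of_int (k i) * M y $ i)"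
  unfolding freq_def adjoint_works[OF linear_M] by (simp add: inner_vec_def mult.commute)

lemma hat_eq_fourier:
  assumes "\<And>y. y \<bullet> z = (\<Sum>i\<in>UNIV. of_int (k i) * M y $ i)"
  shows "hat f k = fourier f z"
  unfolding hat_def fourier_def character_def cis_cnj assms
  by (intro Bochner_Integration.integral_cong refl) (simp add: cis_conv_exp mult_ac)

lemma inj_pt: "inj lattice_pt"
proof (rule injI)
  fix m l assume "lattice_pt m = lattice_pt l"
  then have "M (lattice_pt m) $ i = M (lattice_pt l) $ i" for i by simp
  then show "m = l" by (simp add: M_pt fun_eq_iff)
qed

lemma inner_freq_pt: "lattice_pt m \<bullet> freq k = of_int (\<Sum>i\<in>UNIV. k i * m i)"
  by (simp add: inner_freq M_pt)

lemma inj_freq: "inj freq"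
proof (rule injI)
  fix k l assume eq: "freq k = freq l"
  show "k = l"
  proof
    fix i
    have "L (axis i 1) \<bullet> freq k = L (axis i 1) \<bullet> freq l" using eq by simp
    then show "k i = l i" by (simp add: inner_freq M_L axis_def if_distrib cong: if_cong)
  qed
qed

lemma dual_lattice_eq: "dual_lattice (range lattice_pt) = range freq"
proof (intro equalityI subsetI)
  fix x assume "x \<in> range freq"
  then obtain k where x: "x = freq k" by blast
  show "x \<in> dual_lattice (range lattice_pt)"
    unfolding dual_lattice_def x by (auto simp: inner_commute[of "freq k"] inner_freq_pt)
next
  fix x assume x: "x \<in> dual_lattice (range lattice_pt)"
  define e where "e i = L (axis i 1)" for i
  have e: "e i = lattice_pt (\<lambda>j. if j = i then 1 else 0)" for i
    by (simp add: e_def lattice_pt_def axis_def if_distrib[of of_int] cong: if_cong)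
  have "x \<bullet> e i \<in> \<int>" for i using x by (auto simp: dual_lattice_def e)
  then have "\<forall>i. \<exists>k. x \<bullet> e i = of_int k" by (auto elim: Ints_cases)
  then obtain k where k: "\<And>i. x \<bullet> e i = of_int (k i)" by metis
  have "y \<bullet> x = y \<bullet> freq k" for y
  proof -
    have "M y = (\<Sum>i\<in>UNIV. M y $ i *\<^sub>R axis i 1)"
      by (simp add: vec_eq_iff axis_def if_distrib cong: if_cong)
    then have y: "L (M y) = (\<Sum>i\<in>UNIV. M y $ i *\<^sub>R e i)"
      using linear_L by (metis (no_types, lifting) e_def linear_scale linear_sum sum.cong)
    have "y \<bullet> x = (\<Sum>i\<in>UNIV. M y $ i *\<^sub>R e i) \<bullet> x" using y by (simp only: L_M)
    then have "y \<bullet> x = (\<Sum>i\<in>UNIV. M y $ i * (e i \<bullet> x))" by (simp only: inner_sum_left inner_scaleR_left)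
    then show ?thesis by (simp add: inner_freq k inner_commute[of _ x] mult.commute)
  qed
  then have "(x - freq k) \<bullet> (x - freq k) = 0" by (simp only: inner_diff_right diff_self)
  then have "x = freq k" by simp
  then show "x \<in> range freq" by blast
qed

end

lemma is_lattice_frame:
  fixes \<Lambda> :: "(real ^ 'n) set"
  assumes "is_lattice \<Lambda>"
  obtains L M where "lattice_frame L M" "\<Lambda> = range (lattice_frame.lattice_pt L)"
proof -
  obtain B where B: "independent B" "span B = UNIV"
    and \<Lambda>: "\<Lambda> = {(\<Sum>b\<in>B. of_int (c b) *\<^sub>R b) | c :: real ^ 'n \<Rightarrow> int. True}"
    using assms unfolding is_lattice_def by blast
  have fin: "finite B" using B(1) independent_bound by blast
  have "card B = CARD('n)"
    using dim_eq_card_independent[OF B(1)] dim_span[of B] B(2) by simp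
  then obtain \<beta> :: "'n \<Rightarrow> real ^ 'n" where \<beta>: "bij_betw \<beta> UNIV B"
    using finite_same_card_bij[of "UNIV :: 'n set" B] fin by auto
  define L where "L y = (\<Sum>i\<in>UNIV. y $ i *\<^sub>R \<beta> i)" for y :: "real ^ 'n"
  have L: "linear L"
    unfolding L_def
    by (intro linearI) (simp_all add: scaleR_add_left sum.distrib scaleR_sum_right)
  have "surj L"
  proof -
    have "b \<in> range L" if "b \<in> B" for b
    proof -
      have "b \<in> range \<beta>" using \<beta> that by (simp add: bij_betw_def)
      then obtain j where "b = \<beta> j" by blast
      then have "b = L (axis j 1)" by (simp add: L_def axis_def if_distrib[of "\<lambda>c. c *\<^sub>R _"] cong: if_cong)
      then show ?thesis by blast
    qed
    then have "span B \<subseteq> range L"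
      by (intro span_minimal linear_subspace_image[OF L]) auto
    then show ?thesis using B(2) by blast
  qed
  then obtain M where M: "linear M" "\<forall>x. M (L x) = x" "\<forall>x. L (M x) = x"
    using linear_surjective_isomorphism[OF L] by blast
  have frame: "lattice_frame L M" by (rule lattice_frame.intro) (use L M in auto)
  have "\<Lambda> = range (lattice_frame.lattice_pt L)"
  proof -
    have reindex: "(\<Sum>b\<in>B. of_int (c b) *\<^sub>R b) = lattice_frame.lattice_pt L (\<lambda>i. c (\<beta> i))" for c
      unfolding lattice_frame.lattice_pt_def[OF frame] L_def
      using sum.reindex_bij_betw[OF \<beta>, of "\<lambda>b. of_int (c b) *\<^sub>R b"] by simp
    have inv: "(\<lambda>i. (m \<circ> inv_into UNIV \<beta>) (\<beta> i)) = m" for m :: "'n \<Rightarrow> int"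
      using \<beta> by (simp add: bij_betw_def)
    show ?thesis
    proof (intro equalityI subsetI)
      fix x assume "x \<in> \<Lambda>"
      then obtain c :: "real ^ 'n \<Rightarrow> int" where "x = (\<Sum>b\<in>B. of_int (c b) *\<^sub>R b)" unfolding \<Lambda> by blast
      then show "x \<in> range (lattice_frame.lattice_pt L)" unfolding reindex by blast
    next
      fix x assume "x \<in> range (lattice_frame.lattice_pt L)"
      then obtain m where "x = lattice_frame.lattice_pt L m" by blast
      then have "x = (\<Sum>b\<in>B. of_int ((m \<circ> inv_into UNIV \<beta>) b) *\<^sub>R b)" by (simp only: reindex inv)
      then show "x \<in> \<Lambda>" unfolding \<Lambda> by blast
    qed
  qed
  with frame show thesis by (rule that)
qed

text \<open>Poisson summation is applied to the lattice scaled by \<open>u\<close>, whose dual is the dual lattice divided by \<open>u\<close>, at the point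
\<open>u v\<close>. Dropping the phases and using that the Fourier transform does not increase from \<open>z\<close> to \<open>z / u\<close> leads to the
dual sum of the original lattice, which a second application at the origin turns back into a lattice sum.\<close>

lemma lattice_sum_dilate_le:
  fixes f :: "real ^ 'n \<Rightarrow> real"
  assumes cont: "continuous_on UNIV f"
    and decay: "\<And>x. \<bar>f x\<bar> \<le> C * (1 + norm x) powr (- real CARD('n) - \<delta>)" and "0 < \<delta>"
    and lat: "is_lattice \<Lambda>"
    and summable: "\<And>t. 0 < t \<Longrightarrow> (\<lambda>l. norm (fourier f (t *\<^sub>R l))) summable_on dual_lattice \<Lambda>"
    and nonneg: "\<And>z. fourier f z \<in> \<real> \<and> 0 \<le> Re (fourier f z)"
    and mono: "\<And>z t. 1 \<le> t \<Longrightarrow> Re (fourier f (t *\<^sub>R z)) \<le> Re (fourier f z)"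
    and u: "u \<in> {0<..1}"
  shows "(\<lambda>l. f (u *\<^sub>R (l + v))) summable_on \<Lambda>"
    and "u ^ CARD('n) * (\<Sum>\<^sub>\<infinity>l\<in>\<Lambda>. f (u *\<^sub>R (l + v))) \<le> (\<Sum>\<^sub>\<infinity>l\<in>\<Lambda>. f l)"
proof -
  obtain L M where "lattice_frame L M" and \<Lambda>: "\<Lambda> = range (lattice_frame.lattice_pt L)"
    using is_lattice_frame[OF lat] by metis
  interpret lattice_frame L M by fact
  have u0: "0 < u" "u \<le> 1" using u by auto
  have cancel: "M ((1/u) *\<^sub>R (u *\<^sub>R L y)) = y" "u *\<^sub>R L (M ((1/u) *\<^sub>R x)) = x" for x y
    using u0 by (simp_all add: M_L L_M)
  interpret S: lattice_frame "\<lambda>y. u *\<^sub>R L y" "\<lambda>x. M ((1/u) *\<^sub>R x)"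
  proof (rule lattice_frame.intro)
    show "linear (\<lambda>y. u *\<^sub>R L y)" using linear_L by (rule linear_compose_scale_right)
    show "linear (\<lambda>x. M ((1/u) *\<^sub>R x))"
      using linear_compose[OF linear_scaleR[of "1/u"] linear_M] by (simp add: o_def)
  qed (rule cancel)+
  have norm_fourier: "norm (fourier f z) = Re (fourier f z)" for z
    using nonneg[of z] by (metis Re_complex_of_real Reals_cases abs_of_nonneg norm_of_real)
  have S_pt: "S.lattice_pt m = u *\<^sub>R lattice_pt m" for m by (simp add: S.lattice_pt_def lattice_pt_def)
  have S_vol: "S.covolume = u ^ CARD('n) * covolume"
  proof -
    have "S.cell = (\<lambda>x. u *\<^sub>R x + 0) ` cell"
    proof (intro equalityI subsetI)
      fix x assume "x \<in> S.cell"
      then have "(1/u) *\<^sub>R x \<in> cell" by (simp add: S.cell_def cell_def)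
      moreover have "x = u *\<^sub>R ((1/u) *\<^sub>R x) + 0" using u0 by simp
      ultimately show "x \<in> (\<lambda>x. u *\<^sub>R x + 0) ` cell" by blast
    next
      fix x assume "x \<in> (\<lambda>x. u *\<^sub>R x + 0) ` cell"
      then show "x \<in> S.cell" using u0 by (auto simp: S.cell_def cell_def)
    qed
    then have "measure lebesgue S.cell = u ^ CARD('n) * measure lebesgue cell"
      using measure_lebesgue_affine[of u 0 cell] u0 by simp
    then show ?thesis unfolding S.covolume_def covolume_def
      using cell_borel S.cell_borel by (simp add: measure_completion)
  qed
  have hat: "hat f k = fourier f (freq k)" for k
    by (rule hat_eq_fourier) (rule inner_freq)
  have S_hat: "S.hat f k = fourier f ((1/u) *\<^sub>R freq k)" for k
    by (rule S.hat_eq_fourier)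
      (simp add: inner_freq linear_scale[OF linear_M] sum_divide_distrib)
  have summable': "(\<lambda>k. norm (fourier f (t *\<^sub>R freq k))) summable_on UNIV" if "0 < t" for t
    using summable[OF that] unfolding \<Lambda> dual_lattice_eq
    by (subst (asm) summable_on_reindex[OF inj_freq]) (simp add: o_def)
  have hat_sum: "(\<lambda>k. norm (hat f k)) summable_on UNIV"
    using summable'[of 1] by (simp add: hat)
  have S_hat_sum: "(\<lambda>k. norm (S.hat f k)) summable_on UNIV"
    using summable'[of "1/u"] u0 by (simp add: S_hat)
  note poisson = poisson_summation[OF cont lattice_values_bounded[OF decay \<open>0 < \<delta>\<close>] hat_sum]
  note S_poisson = S.poisson_summation[OF cont S.lattice_values_bounded[OF decay \<open>0 < \<delta>\<close>] S_hat_sum]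
  have S_summable: "(\<lambda>m. f (u *\<^sub>R (lattice_pt m + v))) summable_on UNIV"
    using S.summable_lattice_values[OF decay \<open>0 < \<delta>\<close>, of "u *\<^sub>R v"]
    by (simp add: S_pt scaleR_add_right add.commute)
  then show "(\<lambda>l. f (u *\<^sub>R (l + v))) summable_on \<Lambda>"
    unfolding \<Lambda> by (subst summable_on_reindex[OF inj_pt]) (simp add: o_def)
  have of_real: "(\<Sum>\<^sub>\<infinity>m. complex_of_real (h m)) = of_real (\<Sum>\<^sub>\<infinity>m. h m)"
    if "h summable_on UNIV" for h :: "('n \<Rightarrow> int) \<Rightarrow> real"
    by (rule infsumI) (rule has_sum_of_real[OF has_sum_infsum[OF that]])
  have reindex: "(\<Sum>\<^sub>\<infinity>l\<in>\<Lambda>. h l) = (\<Sum>\<^sub>\<infinity>m. h (lattice_pt m))" for h :: "real ^ 'n \<Rightarrow> real"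
    unfolding \<Lambda> by (subst infsum_reindex[OF inj_pt]) (simp add: o_def)
  have "S.covolume * (\<Sum>\<^sub>\<infinity>m. f (u *\<^sub>R (lattice_pt m + v))) \<le> \<bar>S.covolume * (\<Sum>\<^sub>\<infinity>m. f (u *\<^sub>R (lattice_pt m + v)))\<bar>" by simp
  also have "\<dots> = norm (\<Sum>\<^sub>\<infinity>k. S.hat f k * S.character k (u *\<^sub>R v))"
  proof -
    have "f (u *\<^sub>R v + S.lattice_pt m) = f (u *\<^sub>R (lattice_pt m + v))" for m
      by (simp add: S_pt scaleR_add_right add.commute)
    then have "(\<Sum>\<^sub>\<infinity>k. S.hat f k * S.character k (u *\<^sub>R v)) = of_real (S.covolume * (\<Sum>\<^sub>\<infinity>m. f (u *\<^sub>R (lattice_pt m + v))))"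
      using S_poisson[of "u *\<^sub>R v"] of_real[OF S_summable] by simp
    then show ?thesis by (simp only: norm_of_real)
  qed
  also have "\<dots> \<le> (\<Sum>\<^sub>\<infinity>k. norm (S.hat f k * S.character k (u *\<^sub>R v)))"
    using S_hat_sum by (intro norm_infsum_bound) (simp add: norm_mult)
  also have "\<dots> = (\<Sum>\<^sub>\<infinity>k. norm (S.hat f k))" by (simp add: norm_mult)
  also have "\<dots> \<le> (\<Sum>\<^sub>\<infinity>k. norm (hat f k))"
    using u0 by (intro infsum_mono S_hat_sum hat_sum) (simp add: S_hat hat norm_fourier mono)
  also have "\<dots> = covolume * (\<Sum>\<^sub>\<infinity>m. f (lattice_pt m))"
  proof -
    have "complex_of_real (\<Sum>\<^sub>\<infinity>k. norm (hat f k)) = (\<Sum>\<^sub>\<infinity>k. hat f k * character k 0)"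
    proof -
      have "complex_of_real (norm (hat f k)) = hat f k * character k 0" for k
      proof -
        have "character k 0 = 1" using character_pt[of k "\<lambda>_. 0"] by (simp add: lattice_pt_def linear_0[OF linear_L] flip: zero_vec_def)
        moreover have "complex_of_real (Re (hat f k)) = hat f k"
          using nonneg[of "freq k"] by (auto simp: hat elim: Reals_cases)
        ultimately show ?thesis by (simp add: hat norm_fourier)
      qed
      then show ?thesis using of_real[OF hat_sum] by simp
    qed
    also have "\<dots> = of_real (covolume * (\<Sum>\<^sub>\<infinity>m. f (lattice_pt m)))"
      using poisson[of 0] of_real summable_lattice_values[OF decay \<open>0 < \<delta>\<close>, of 0] by simp
    finally show ?thesis by (simp only: of_real_eq_iff)
  qed
  finally have "covolume * (u ^ CARD('n) * (\<Sum>\<^sub>\<infinity>m. f (u *\<^sub>R (lattice_pt m + v)))) \<le> covolume * (\<Sum>\<^sub>\<infinity>m. f (lattice_pt m))"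
    by (simp add: S_vol mult_ac)
  then show "u ^ CARD('n) * (\<Sum>\<^sub>\<infinity>l\<in>\<Lambda>. f (u *\<^sub>R (l + v))) \<le> (\<Sum>\<^sub>\<infinity>l\<in>\<Lambda>. f l)"
    unfolding reindex using covolume_pos by (simp only: mult_le_cancel_left_pos)
qed

section \<open>Starlike gauges and the tail bound\<close>

text \<open>The asymptotic bound controls \<open>f\<close> outside some ball; on the ball, \<open>f\<close> divided by the decay rate is bounded by
compactness.\<close>

lemma decay_bound_global:
  fixes f :: "real ^ 'n \<Rightarrow> real"
  assumes cont: "continuous_on UNIV f" and O: "f \<in> O[at_infinity](\<lambda>x. (1 + norm x) powr p)"
  obtains C where "\<And>x. \<bar>f x\<bar> \<le> C * (1 + norm x) powr p"
proof -
  obtain c where "c > 0" and c: "\<forall>\<^sub>F x in at_infinity. norm (f x) \<le> c * norm ((1 + norm x) powr p)"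
    using O by (elim landau_o.bigE)
  obtain b where b: "\<And>x. b \<le> norm x \<Longrightarrow> \<bar>f x\<bar> \<le> c * (1 + norm x) powr p"
    using c unfolding eventually_at_infinity by auto
  have pos: "0 < 1 + norm x" for x :: "real ^ 'n" by (simp add: add_pos_nonneg)
  define h where "h x = f x * (1 + norm x) powr (- p)" for x
  have "continuous_on (cball 0 b) h"
    unfolding h_def using pos
    by (intro continuous_intros continuous_on_subset[OF cont]) (auto simp: less_imp_neq[symmetric])
  then have "compact (h ` cball 0 b)" by (intro compact_continuous_image compact_cball)
  then obtain a where a: "\<And>x. norm x \<le> b \<Longrightarrow> \<bar>h x\<bar> \<le> a"
    using compact_imp_bounded bounded_iff by (metis imageI mem_cball_0 real_norm_def)
  have "\<bar>f x\<bar> \<le> max a c * (1 + norm x) powr p" for x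
  proof (cases "b \<le> norm x")
    case True
    have "c * (1 + norm x) powr p \<le> max a c * (1 + norm x) powr p" by (intro mult_right_mono) auto
    then show ?thesis using b[OF True] by linarith
  next
    case False
    have "\<bar>f x\<bar> = \<bar>h x\<bar> * (1 + norm x) powr p"
      using pos[of x] by (simp add: h_def abs_mult powr_minus field_simps)
    also have "\<dots> \<le> max a c * (1 + norm x) powr p"
      using a[of x] False by (intro mult_right_mono) auto
    finally show ?thesis .
  qed
  then show thesis by (rule that)
qed

lemma mem_dilate_scaleR:
  assumes "0 < s"
  shows "s *\<^sub>R x \<in> dilate (s * r) K \<longleftrightarrow> x \<in> dilate r K"
proof -
  have "s *\<^sub>R x = (s * r) *\<^sub>R y \<longleftrightarrow> x = r *\<^sub>R y" for y
    using assms by (simp add: scaleR_scaleR[symmetric] del: scaleR_scaleR)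
  then show ?thesis unfolding dilate_def image_iff by simp
qed

lemma knorm_zero: "0 \<in> K \<Longrightarrow> knorm K 0 = 0"
  unfolding knorm_def by (rule Least_equality) (auto simp: dilate_def)

lemma knorm_le_iff:
  assumes "starlike_origin K" "0 < r"
  shows "knorm K x \<le> r \<longleftrightarrow> x \<in> dilate r K"
  using assms unfolding starlike_origin_def by (meson not_le)

text \<open>A bounded set is too small to contain \<open>x\<close> after scaling by less than \<open>norm x / b\<close>, where \<open>b\<close> bounds the set.\<close>

lemma knorm_pos:
  assumes star: "starlike_origin K" and "bounded K" and "x \<noteq> 0"
  shows "0 < knorm K x"
proof -
  obtain b where b: "0 < b" "\<And>y. y \<in> K \<Longrightarrow> norm y \<le> b"
    using \<open>bounded K\<close> bounded_pos by metis
  define r where "r = norm x / (2 * b)"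
  have r: "0 < r" using b(1) \<open>x \<noteq> 0\<close> by (simp add: r_def)
  have "x \<notin> dilate r K"
  proof
    assume "x \<in> dilate r K"
    then obtain y where "y \<in> K" "x = r *\<^sub>R y" by (auto simp: dilate_def)
    then have "norm x \<le> r * b" using r b(2) by (simp add: mult_left_mono)
    then show False using b(1) \<open>x \<noteq> 0\<close> by (simp add: r_def)
  qed
  then show ?thesis using knorm_le_iff[OF star r, of x] r by linarith
qed

text \<open>Both sides are positive away from the origin, and by \<open>knorm_le_iff\<close> they have the same positive upper bounds.\<close>

lemma knorm_scaleR:
  assumes star: "starlike_origin K" and K: "bounded K" "0 \<in> K" and "0 < s"
  shows "knorm K (s *\<^sub>R x) = s * knorm K x"
proof (cases "x = 0")
  case True
  then show ?thesis using knorm_zero[OF K(2)] by simp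
next
  case False
  have iff: "knorm K (s *\<^sub>R x) \<le> s * r \<longleftrightarrow> knorm K x \<le> r" if "0 < r" for r
    using that \<open>0 < s\<close> by (simp add: knorm_le_iff[OF star] mem_dilate_scaleR)
  have pos: "0 < knorm K x" "0 < knorm K (s *\<^sub>R x)"
    using False \<open>0 < s\<close> by (simp_all add: knorm_pos[OF star K(1)])
  show ?thesis
  proof (rule antisym)
    show "knorm K (s *\<^sub>R x) \<le> s * knorm K x" using iff[OF pos(1)] by simp
    show "s * knorm K x \<le> knorm K (s *\<^sub>R x)"
      using iff[of "knorm K (s *\<^sub>R x) / s"] pos(2) \<open>0 < s\<close> by (simp add: field_simps)
  qed
qed

text \<open>If \<open>I\<close> is positive, each hypothesis says \<open>h u \<le> c / I\<close>, so \<open>c / I\<close> bounds the supremum too. Boundedness of \<open>h\<close>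
makes the supremum positive, which is what the inequality needs when solved for \<open>I\<close>.\<close>

lemma le_divide_SUP:
  fixes h :: "'a \<Rightarrow> real"
  assumes "A \<noteq> {}" "bdd_above (h ` A)" and h: "\<And>u. u \<in> A \<Longrightarrow> 0 < h u"
    and "0 \<le> c" and le: "\<And>u. u \<in> A \<Longrightarrow> I \<le> c / h u"
  shows "I \<le> c / (SUP u\<in>A. h u)"
proof -
  obtain a where a: "a \<in> A" using assms(1) by blast
  have S: "0 < (SUP u\<in>A. h u)"
    using h[OF a] cSUP_upper[OF a assms(2)] by linarith
  show ?thesis
  proof (cases "0 < I")
    case True
    have "(SUP u\<in>A. h u) \<le> c / I"
      using le h True by (intro cSUP_least[OF assms(1)]) (simp add: field_simps)
    then show ?thesis using True S by (simp add: field_simps)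
  next
    case False
    then show ?thesis using S \<open>0 \<le> c\<close> by (meson divide_nonneg_pos not_less order_trans)
  qed
qed

theorem corollary2p12:
  fixes K :: "(real ^ 'n) set" and g :: "real \<Rightarrow> real" and f :: "real ^ 'n \<Rightarrow> real"
  assumes "compact K" and "0 \<in> interior K" and "starlike_origin K"
    and "\<And>s. 0 \<le> s \<Longrightarrow> 0 < g s" and "inj_on g {0..}"
    and "\<And>x. f x = g (knorm K x)"
    and a: "\<And>x u t. u \<in> {0<..1} \<Longrightarrow> t \<in> {0<..1} \<Longrightarrow>
              f (u *\<^sub>R x) / f x \<ge> f ((u * t) *\<^sub>R x) / f (t *\<^sub>R x)"
    and b: "continuous_on UNIV f"
    and c: "\<exists>\<delta>>0. f \<in> O[at_infinity](\<lambda>x. (1 + norm x) powr (- real CARD('n) - \<delta>))"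
    and d: "\<And>\<Lambda> t. is_lattice \<Lambda> \<Longrightarrow> 0 < t \<Longrightarrow>
              (\<lambda>l. norm (fourier f (t *\<^sub>R l))) summable_on dual_lattice \<Lambda>"
    and e: "\<And>v. fourier f v \<in> \<real> \<and> 0 \<le> Re (fourier f v)"
           "\<And>v t. 1 \<le> t \<Longrightarrow> Re (fourier f (t *\<^sub>R v)) \<le> Re (fourier f v)"
    and "0 < r"
  shows "nu f (dilate r K) \<le> ereal (mu CARD('n) g r) \<and>
    (\<forall>\<Lambda> v. is_lattice \<Lambda> \<longrightarrow>
       (\<lambda>l. f (l + v)) summable_on {l \<in> \<Lambda>. r \<le> knorm K (l + v)} \<and>
       f summable_on \<Lambda> \<and>
       (\<Sum>\<^sub>\<infinity>l\<in>{l \<in> \<Lambda>. r \<le> knorm K (l + v)}. f (l + v)) \<le> mu CARD('n) g r * (\<Sum>\<^sub>\<infinity>l\<in>\<Lambda>. f l))"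
proof -
  note star = \<open>starlike_origin K\<close> and g_pos = \<open>\<And>s. 0 \<le> s \<Longrightarrow> 0 < g s\<close>
    and f_eq = \<open>\<And>x. f x = g (knorm K x)\<close>
  have K: "bounded K" "0 \<in> K"
    using \<open>compact K\<close> \<open>0 \<in> interior K\<close> compact_imp_bounded interior_subset by blast+
  obtain \<delta> where \<delta>: "0 < \<delta>" "f \<in> O[at_infinity](\<lambda>x. (1 + norm x) powr (- real CARD('n) - \<delta>))"
    using c by blast
  obtain C where C: "\<And>x. \<bar>f x\<bar> \<le> C * (1 + norm x) powr (- real CARD('n) - \<delta>)"
    using decay_bound_global[OF b \<delta>(2)] by blast
  note knorm_scale = knorm_scaleR[OF star K]
  have knorm_nonneg: "0 \<le> knorm K x" for x
    using knorm_zero[OF K(2)] knorm_pos[OF star K(1)] by (cases "x = 0") (auto intro: less_imp_le)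
  have f_pos: "0 < f x" for x using g_pos knorm_nonneg f_eq by simp
  define h where "h u = u ^ CARD('n) * g (u * r)" for u
  have h_pos: "0 < h u" if "u \<in> {0<..1}" for u
    using that g_pos \<open>0 < r\<close> by (simp add: h_def)
  have mu_eq: "mu CARD('n) g r = g r / (SUP u\<in>{0<..1}. h u)"
    by (simp add: mu_def h_def)
  \<comment> \<open>The values of \<open>g\<close> on positive reals are values of \<open>f\<close> on the ray through any nonzero vector \<open>x\<close>, so the global
  bound on \<open>f\<close> shows that the supremum in \<open>\<mu>\<close> is taken over a bounded set.\<close>
  have "h u \<le> C" if u: "u \<in> {0<..1}" for u
  proof -
    define x where "x = (axis undefined 1 :: real ^ 'n)"
    have "x \<noteq> 0" by (simp add: x_def axis_eq_0_iff)
    then have x: "0 < knorm K x" by (rule knorm_pos[OF star K(1)])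
    define y where "y = (u * r / knorm K x) *\<^sub>R x"
    have "knorm K y = u * r" unfolding y_def using x u \<open>0 < r\<close> by (subst knorm_scale) auto
    then have "g (u * r) = f y" by (simp add: f_eq)
    also have "\<dots> \<le> C * (1 + norm y) powr (- real CARD('n) - \<delta>)" using C[of y] by linarith
    also have "\<dots> \<le> C * 1"
    proof (rule mult_left_mono)
      have "(1 + norm y) powr (- real CARD('n) - \<delta>) \<le> (1 + norm y) powr 0"
        using \<delta>(1) by (intro powr_mono) auto
      also have "\<dots> \<le> 1" by simp
      finally show "(1 + norm y) powr (- real CARD('n) - \<delta>) \<le> 1" .
      show "0 \<le> C" using order_trans[OF abs_ge_zero C[of 0]] by simp
    qed
    finally have "g (u * r) \<le> C" by simp
    moreover have "h u \<le> 1 * g (u * r)"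
      unfolding h_def using u \<open>0 < r\<close>
      by (intro mult_right_mono power_le_one less_imp_le[OF g_pos]) auto
    ultimately show ?thesis by simp
  qed
  then have bdd: "bdd_above (h ` {0<..1})" by (intro bdd_aboveI2)
  have key: "f x \<le> g r / g (u * r) * f (u *\<^sub>R x)" if u: "u \<in> {0<..1}" and x: "r \<le> knorm K x" for u x
  proof -
    \<comment> \<open>The factor \<open>t\<close> moves \<open>x\<close> to gauge exactly \<open>r\<close>.\<close>
    define t where "t = r / knorm K x"
    have t: "t \<in> {0<..1}" using x \<open>0 < r\<close> by (auto simp: t_def)
    have "f (t *\<^sub>R x) = g r" using t x \<open>0 < r\<close> by (simp add: f_eq knorm_scale) (simp add: t_def)
    moreover have "f ((u * t) *\<^sub>R x) = g (u * r)"
      using t u x \<open>0 < r\<close> by (simp add: f_eq knorm_scale) (simp add: t_def)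
    ultimately have "g (u * r) / g r \<le> f (u *\<^sub>R x) / f x" using a[OF u t, of x] by simp
    then show ?thesis using f_pos[of x] g_pos[of r] g_pos[of "u * r"] u \<open>0 < r\<close> by (simp add: field_simps)
  qed
  have "nu f (dilate r K) \<le> ereal (mu CARD('n) g r)"
  proof -
    have le: "nu f (dilate r K) \<le> ereal (g r / h u)" if u: "u \<in> {0<..1}" for u
    proof -
      have "nu f (dilate r K) \<le> (SUP x\<in>- dilate r K. ereal (f x / (u ^ CARD('n) * f (u *\<^sub>R x))))"
        unfolding nu_def using u by (rule INF_lower)
      also have "\<dots> \<le> ereal (g r / h u)"
      proof (rule SUP_least)
        fix x assume "x \<in> - dilate r K"
        then have "r \<le> knorm K x" using knorm_le_iff[OF star \<open>0 < r\<close>, of x] by auto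
        from key[OF u this] show "ereal (f x / (u ^ CARD('n) * f (u *\<^sub>R x))) \<le> ereal (g r / h u)"
          using f_pos[of "u *\<^sub>R x"] g_pos[of "u * r"] u \<open>0 < r\<close> by (simp add: h_def field_simps)
      qed
      finally show ?thesis .
    qed
    show ?thesis
    proof (cases "nu f (dilate r K)")
      case (real I)
      then have "I \<le> g r / (SUP u\<in>{0<..1}. h u)"
        using le g_pos[of r] \<open>0 < r\<close> by (intro le_divide_SUP bdd h_pos) auto
      then show ?thesis by (simp add: real mu_eq)
    next
      case PInf
      then show ?thesis using le[of 1] by simp
    qed simp
  qed
  moreover have "(\<lambda>l. f (l + v)) summable_on {l \<in> \<Lambda>. r \<le> knorm K (l + v)}"
    and "f summable_on \<Lambda>"
    and "(\<Sum>\<^sub>\<infinity>l\<in>{l \<in> \<Lambda>. r \<le> knorm K (l + v)}. f (l + v)) \<le> mu CARD('n) g r * (\<Sum>\<^sub>\<infinity>l\<in>\<Lambda>. f l)"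
    if \<Lambda>: "is_lattice \<Lambda>" for \<Lambda> v
  proof -
    let ?F = "{l \<in> \<Lambda>. r \<le> knorm K (l + v)}"
    note dilate = lattice_sum_dilate_le[OF b C \<delta>(1) \<Lambda> d[OF \<Lambda>] e]
    show f_sum: "f summable_on \<Lambda>" using dilate(1)[of 1 0] by simp
    show far: "(\<lambda>l. f (l + v)) summable_on ?F"
      using dilate(1)[of 1 v] by (simp add: summable_on_subset_banach)
    have "(\<Sum>\<^sub>\<infinity>l\<in>?F. f (l + v)) \<le> g r * (\<Sum>\<^sub>\<infinity>l\<in>\<Lambda>. f l) / h u" if u: "u \<in> {0<..1}" for u
    proof -
      define k where "k = g r / g (u * r)"
      have k: "0 < k" using g_pos u \<open>0 < r\<close> by (simp add: k_def)
      have "(\<Sum>\<^sub>\<infinity>l\<in>?F. f (l + v)) \<le> (\<Sum>\<^sub>\<infinity>l\<in>\<Lambda>. k * f (u *\<^sub>R (l + v)))"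
        using u f_pos k key[OF u, folded k_def]
        by (intro infsum_mono_neutral far summable_on_cmult_right dilate(1)) (auto intro: less_imp_le)
      also have "\<dots> = g r / h u * (u ^ CARD('n) * (\<Sum>\<^sub>\<infinity>l\<in>\<Lambda>. f (u *\<^sub>R (l + v))))"
      proof -
        have "k = g r / h u * u ^ CARD('n)" using u by (simp add: h_def k_def)
        then show ?thesis by (simp only: infsum_cmult_right' mult.assoc)
      qed
      also have "\<dots> \<le> g r / h u * (\<Sum>\<^sub>\<infinity>l\<in>\<Lambda>. f l)"
        using g_pos[of r] \<open>0 < r\<close> h_pos[OF u] by (intro mult_left_mono dilate(2) u) auto
      finally show ?thesis by simp
    qed
    moreover have "0 \<le> g r * (\<Sum>\<^sub>\<infinity>l\<in>\<Lambda>. f l)"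
      using g_pos[of r] \<open>0 < r\<close> f_pos by (intro mult_nonneg_nonneg infsum_nonneg) (auto intro: less_imp_le)
    ultimately have "(\<Sum>\<^sub>\<infinity>l\<in>?F. f (l + v)) \<le> g r * (\<Sum>\<^sub>\<infinity>l\<in>\<Lambda>. f l) / (SUP u\<in>{0<..1}. h u)"
      by (intro le_divide_SUP bdd h_pos) auto
    then show "(\<Sum>\<^sub>\<infinity>l\<in>?F. f (l + v)) \<le> mu CARD('n) g r * (\<Sum>\<^sub>\<infinity>l\<in>\<Lambda>. f l)"
      by (simp add: mu_eq)
  qed
  ultimately show ?thesis by blast
qed

end
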